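(* The relation of complete order isomorphism of finitely generated operator systems is smooth. That is, let $\Gamma_{\mathrm{fg}}$ be the standard Borel space of sequences $\gamma\in B(H)^{\mathbb{N}}$ such that the operator system $\mathcal{OS}y(\gamma)$ is finite-dimensional; then the equivalence relation on $\Gamma_{\mathrm{fg}}$ defined by $\gamma\sim\gamma'$ if and only if $\mathcal{OS}y(\gamma)$ and $\mathcal{OS}y(\gamma')$ are completely order isomorphic is smooth.
   Context: An operator system is a closed unital self-adjoint subspace of a unital C*-algebra; it is finitely generated exactly when it is finite-dimensional. A linear map $\phi:X\to Y$ between operator systems is unital completely positive if $\phi(1)=1$ and for all $n$ the amplification $\phi^{(n)}:M_n(X)\to M_n(Y)$, $[x_{ij}]\mapsto[\phi(x_{ij})]$, sends positive elements to positive elements. A complete order isomorphism is a bijective unital completely positive map with unital completely positive inverse. $H$ is the separable infinite-dimensional Hilbert space. $B(H)$ has the Borel structure in which $A\subset B(H)$ is Borel iff for every $n$ the set $A\cap\{x:\|x\|\le n\}$ is Borel for the weak operator topology on $\{x:\|x\|\le n\}$; this is a standard Borel structure, and $\Gamma=B(H)^{\mathbb{N}}$ has the product Borel structure. For $\gamma=(\gamma_n)_{n\in\mathbb{N}}\in\Gamma$, $\mathcal{OS}y(\gamma)$ is the norm-closed linear span of $\{I\}\cup\{\gamma_n,\gamma_n^*:n\in\mathbb{N}\}$. The set $\Gamma_{\mathrm{fg}}$ is a Borel subset of $\Gamma$. For equivalence relations $E,F$ on standard Borel spaces $X,Y$, $E$ is Borel reducible to $F$ if there is a Borel $f:X\to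 Y$ with $x\,E\,x'\iff f(x)\,F\,f(x')$. $E$ is smooth if it is Borel reducible to the equality relation on $\mathbb{R}$ (equivalently, on some Polish space). *)

theory Defs
  imports "HOL-Analysis.Analysis" "HOL-Library.Nonpos_Ints"
begin

text \<open>Complex Hilbert spaces, with inner product linear in the first argument. Completeness
  and the norm come from \<^class>\<open>banach\<close>.\<close>

class chilbert_space = banach +
  fixes scaleC :: "complex \<Rightarrow> 'a \<Rightarrow> 'a" (infixr "*\<^sub>C" 75)
    and cinner :: "'a \<Rightarrow> 'a \<Rightarrow> complex"
  assumes scaleC_add_right: "c *\<^sub>C (x + y) = c *\<^sub>C x + c *\<^sub>C y"
    and scaleC_add_left: "(c + d) *\<^sub>C x = c *\<^sub>C x + d *\<^sub>C x"
    and scaleC_scaleC: "c *\<^sub>C d *\<^sub>C x = (c * d) *\<^sub>C x"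
    and scaleC_of_real: "complex_of_real r *\<^sub>C x = r *\<^sub>R x"
    and cinner_add_left: "cinner (x + y) z = cinner x z + cinner y z"
    and cinner_scaleC_left: "cinner (c *\<^sub>C x) y = c * cinner x y"
    and cinner_commute: "cinner x y = cnj (cinner y x)"
    and cinner_self: "cinner x x = complex_of_real ((norm x)\<^sup>2)"

lemma scaleC_one [simp]: "1 *\<^sub>C x = (x :: 'h :: chilbert_space)"
  using scaleC_of_real[of 1 x] by simp

lemma vector_space_scaleC: "vector_space (scaleC :: complex \<Rightarrow> 'h \<Rightarrow> 'h :: chilbert_space)"
  by unfold_locales (simp_all add: scaleC_add_right scaleC_add_left scaleC_scaleC)

lemma norm_scaleC: "norm (c *\<^sub>C x) = cmod c * norm (x :: 'h :: chilbert_space)"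
proof -
  have "cinner x (c *\<^sub>C x) = cnj c * cinner x x"
    using cinner_commute[of x "c *\<^sub>C x"] by (simp add: cinner_scaleC_left cinner_self)
  then have "complex_of_real ((norm (c *\<^sub>C x))\<^sup>2) = (c * cnj c) * complex_of_real ((norm x)\<^sup>2)"
    unfolding cinner_self[symmetric] by (simp add: cinner_scaleC_left)
  also have "c * cnj c = complex_of_real ((cmod c)\<^sup>2)"
    by (rule complex_norm_square[symmetric])
  finally have "(norm (c *\<^sub>C x))\<^sup>2 = (cmod c * norm x)\<^sup>2"
    by (simp only: of_real_mult[symmetric] of_real_eq_iff power_mult_distrib)
  then show ?thesis
    by (rule power2_eq_imp_eq) simp_all
qed

text \<open>A linear subspace is finite-dimensional if it is spanned by a finite set;
  \<open>sc\<close> is the complex scalar multiplication in question.\<close>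

definition fin_dim :: "(complex \<Rightarrow> 'v \<Rightarrow> 'v) \<Rightarrow> 'v :: ab_group_add set \<Rightarrow> bool" where
  "fin_dim sc X \<longleftrightarrow> (\<exists>B. finite B \<and> module.span sc B = X)"

text \<open>The type of \<^emph>\<open>real\<close>-linear bounded operators carries the operator norm; the space of
  bounded complex-linear operators is the closed subspace \<open>BH\<close>.\<close>

type_synonym 'h op = "'h \<Rightarrow>\<^sub>L 'h"

definition BH :: "'h :: chilbert_space op set" where
  "BH = {T. \<forall>c x. blinfun_apply T (c *\<^sub>C x) = c *\<^sub>C blinfun_apply T x}"

lift_definition op_scaleC :: "complex \<Rightarrow> 'h op \<Rightarrow> 'h :: chilbert_space op"
  is "\<lambda>c T x. c *\<^sub>C T x"
proof -
  fix c :: complex and T :: "'h \<Rightarrow> 'h"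
  assume T: "bounded_linear T"
  have "bounded_linear (\<lambda>x :: 'h. c *\<^sub>C x)"
  proof (rule bounded_linear_intro[where K = "cmod c"])
    show "c *\<^sub>C (x + y) = c *\<^sub>C x + c *\<^sub>C y" for x y :: 'h
      by (rule scaleC_add_right)
    show "c *\<^sub>C (r *\<^sub>R x) = r *\<^sub>R (c *\<^sub>C x)" for r and x :: 'h
      unfolding scaleC_of_real[symmetric] scaleC_scaleC by (simp only: mult.commute)
    show "norm (c *\<^sub>C x) \<le> norm x * cmod c" for x :: 'h
      by (simp only: norm_scaleC mult.commute order_refl)
  qed
  from bounded_linear_compose[OF this T] show "bounded_linear (\<lambda>x. c *\<^sub>C T x)" .
qed

lemma vector_space_op_scaleC:
  "vector_space (op_scaleC :: complex \<Rightarrow> 'h op \<Rightarrow> 'h :: chilbert_space op)"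
  by unfold_locales
    (rule blinfun_eqI,
     simp add: op_scaleC.rep_eq blinfun.add_left scaleC_add_right scaleC_add_left scaleC_scaleC)+

definition adj :: "'h op \<Rightarrow> 'h :: chilbert_space op" where
  "adj T = (THE S. S \<in> BH \<and>
     (\<forall>x y. cinner (blinfun_apply T x) y = cinner x (blinfun_apply S y)))"

definition wot :: "'h :: chilbert_space op topology" where
  "wot = topology_generated_by
     {{T \<in> BH. cinner (blinfun_apply T x) y \<in> U} | x y U. open U}"

definition BH_ball :: "nat \<Rightarrow> 'h :: chilbert_space op set" where
  "BH_ball n = {T \<in> BH. norm T \<le> real n}"

definition borel_sets_of :: "'v topology \<Rightarrow> 'v set set" where
  "borel_sets_of X = sigma_sets (topspace X) {U. openin X U}"

definition BH_borel :: "'h :: chilbert_space op measure" where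
  "BH_borel = sigma BH
     {A. A \<subseteq> BH \<and> (\<forall>n. A \<inter> BH_ball n \<in> borel_sets_of (subtopology wot (BH_ball n)))}"

lemma topspace_wot: "topspace wot = BH"
proof -
  have "BH = {T \<in> BH. cinner (blinfun_apply T 0) 0 \<in> UNIV}" by simp
  then have "BH \<in> {{T \<in> BH. cinner (blinfun_apply T x) y \<in> U} | x y U. open U}"
    using open_UNIV by blast
  then show ?thesis
    unfolding wot_def topology_generated_by_topspace by blast
qed

text \<open>The collection generating \<^const>\<open>BH_borel\<close> is already a sigma-algebra.\<close>

lemma sets_BH_borel:
  "sets BH_borel =
     {A. A \<subseteq> BH \<and> (\<forall>n. A \<inter> BH_ball n \<in> borel_sets_of (subtopology wot (BH_ball n)))}"
    (is "_ = ?\<A>")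
proof -
  have sa: "sigma_algebra (BH_ball n) (borel_sets_of (subtopology wot (BH_ball n)))" for n
  proof -
    have "topspace (subtopology wot (BH_ball n)) = BH_ball n"
      by (auto simp: topspace_wot BH_ball_def)
    then show ?thesis
      unfolding borel_sets_of_def
      by (metis (no_types, lifting) Pow_iff mem_Collect_eq openin_subset sigma_algebra_sigma_sets
          subsetI)
  qed
  have "sigma_algebra BH ?\<A>"
    unfolding sigma_algebra_iff2
  proof (intro conjI ballI allI impI)
    show "?\<A> \<subseteq> Pow BH" by auto
    show "{} \<in> ?\<A>"
      using sigma_algebra.axioms(1)[OF sa] by (auto simp: algebra_iff_Un)
  next
    fix A assume A: "A \<in> ?\<A>"
    have "(BH - A) \<inter> BH_ball n = BH_ball n - A \<inter> BH_ball n" for n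
      by (auto simp: BH_ball_def)
    moreover have "BH_ball n - A \<inter> BH_ball n \<in> borel_sets_of (subtopology wot (BH_ball n))" for n
      using A sa[of n] unfolding sigma_algebra_iff2 mem_Collect_eq by blast
    ultimately show "BH - A \<in> ?\<A>"
      by simp
  next
    fix A :: "nat \<Rightarrow> 'a op set" assume A: "range A \<subseteq> ?\<A>"
    have "(\<Union>(range A)) \<inter> BH_ball n = (\<Union>i. A i \<inter> BH_ball n)" for n by auto
    moreover have "(\<Union>i. A i \<inter> BH_ball n) \<in> borel_sets_of (subtopology wot (BH_ball n))" for n
      using A by (intro sigma_algebra.countable_nat_UN[OF sa]) auto
    ultimately show "\<Union>(range A) \<in> ?\<A>"
      using A by auto
  qed
  then show ?thesis
    unfolding BH_borel_def by (simp add: sigma_algebra.sets_measure_of_eq)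
qed

definition Gamma :: "(nat \<Rightarrow> 'h :: chilbert_space op) measure" where
  "Gamma = (\<Pi>\<^sub>M n\<in>UNIV. BH_borel)"

definition OSy :: "(nat \<Rightarrow> 'h op) \<Rightarrow> 'h :: chilbert_space op set" where
  "OSy \<gamma> = closure (module.span op_scaleC ({id_blinfun} \<union> range \<gamma> \<union> adj ` range \<gamma>))"

definition Gamma_fg :: "(nat \<Rightarrow> 'h :: chilbert_space op) set" where
  "Gamma_fg = {\<gamma> \<in> space Gamma. fin_dim op_scaleC (OSy \<gamma>)}"

text \<open>A matrix of operators \<open>[a\<^sub>i\<^sub>j]\<close> in \<open>M\<^sub>n(B(H)) = B(H\<^sup>n)\<close> acts by
  \<open>(a \<xi>)\<^sub>i = \<Sum>j<n. a\<^sub>i\<^sub>j \<xi>\<^sub>j\<close>; it is positive iff \<open>\<langle>a \<xi>, \<xi>\<rangle> \<ge> 0\<close> for all \<open>\<xi> \<in> H\<^sup>n\<close>.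
  Matrices and vectors are given by functions on \<open>nat\<close> of which only the entries
  with indices below \<open>n\<close> matter.\<close>

definition mat_pos :: "nat \<Rightarrow> (nat \<Rightarrow> nat \<Rightarrow> 'h :: chilbert_space op) \<Rightarrow> bool" where
  "mat_pos n a \<longleftrightarrow> (\<forall>\<xi> :: nat \<Rightarrow> 'h.
     (\<Sum>i<n. cinner (\<Sum>j<n. blinfun_apply (a i j) (\<xi> j)) (\<xi> i)) \<in> \<real>\<^sub>\<ge>\<^sub>0)"

definition ucp :: "'h :: chilbert_space op set \<Rightarrow> 'h op set \<Rightarrow> ('h op \<Rightarrow> 'h op) \<Rightarrow> bool" where
  "ucp X Y \<phi> \<longleftrightarrow>
     \<phi> \<in> X \<rightarrow> Y \<and>
     (\<forall>x\<in>X. \<forall>y\<in>X. \<phi> (x + y) = \<phi> x + \<phi> y) \<and>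
     (\<forall>c. \<forall>x\<in>X. \<phi> (op_scaleC c x) = op_scaleC c (\<phi> x)) \<and>
     \<phi> id_blinfun = id_blinfun \<and>
     (\<forall>n a. (\<forall>i<n. \<forall>j<n. a i j \<in> X) \<longrightarrow> mat_pos n a \<longrightarrow> mat_pos n (\<lambda>i j. \<phi> (a i j)))"

definition complete_order_iso :: "'h :: chilbert_space op set \<Rightarrow> 'h op set \<Rightarrow> bool" where
  "complete_order_iso X Y \<longleftrightarrow>
     (\<exists>\<phi>. bij_betw \<phi> X Y \<and> ucp X Y \<phi> \<and> ucp Y X (inv_into X \<phi>))"

definition borel_reducible ::
    "'x measure \<Rightarrow> ('x \<Rightarrow> 'x \<Rightarrow> bool) \<Rightarrow> 'y measure \<Rightarrow> ('y \<Rightarrow> 'y \<Rightarrow> bool) \<Rightarrow> bool" where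
  "borel_reducible M E N F \<longleftrightarrow>
     (\<exists>f \<in> M \<rightarrow>\<^sub>M N. \<forall>x\<in>space M. \<forall>x'\<in>space M. E x x' \<longleftrightarrow> F (f x) (f x'))"

definition smooth_relation :: "'x measure \<Rightarrow> ('x \<Rightarrow> 'x \<Rightarrow> bool) \<Rightarrow> bool" where
  "smooth_relation M E \<longleftrightarrow> borel_reducible M E (borel :: real measure) (=)"

end

theory Submission
  imports Defs
begin

text \<open>For a matrix \<open>a\<close> over \<open>B(H)\<close> let the defect of \<open>a\<close> be the least \<open>e \<ge> 0\<close> such that
  \<open>Re \<langle>a \<xi>, \<xi>\<rangle> \<ge> - e \<parallel>\<xi>\<parallel>\<^sup>2\<close> and \<open>\<bar>Im \<langle>a \<xi>, \<xi>\<rangle>\<bar> \<le> e \<parallel>\<xi>\<parallel>\<^sup>2\<close> for all \<open>\<xi>\<close>. It is Lipschitz in \<open>a\<close>, is a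
  Borel function of \<open>a\<close>, vanishes exactly on the positive matrices, and is preserved by complete
  order isomorphisms. Hence each statement ``some tuple in the operator system has the defects of
  finitely many given rational linear pencils in given rational intervals'' is an invariant of
  complete order isomorphism. It is open in the tuple, so tuples of Gaussian-rational combinations
  of the generators suffice and it defines a Borel set of sequences. Conversely, if two
  finite-dimensional operator systems satisfy the same statements, then by compactness a spanning
  tuple of the first has a counterpart in the second with the same defects for all pencils, which
  gives a complete order embedding. Embeddings in both directions force equal dimensions, so they
  are isomorphisms. Countably many Borel invariants separating the classes yield smoothness.\<close>

section \<open>Complex Hilbert spaces and adjoints\<close>

text \<open>Positivity itself would not serve as an invariant: it is a closed condition, destroyed
  by small perturbations, so a rational approximant could not replace a tuple. A number measuring
  the failure of positivity can be confined to an open interval instead. The statements quantify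
  over all tuples of a given length, so no Borel choice of a basis is made and linear dependence is
  allowed. Pencils have arbitrary complex coefficients and need not be self-adjoint; hence the
  defect also controls the imaginary part of the quadratic form. Its invariance rests on the unit:
  almost positivity with constant \<open>e\<close> says that \<open>e\<close> plus the real part and
  \<open>e\<close> plus or minus the imaginary part are positive matrices. The compactness argument
  needs an a priori bound on the approximating tuples. It comes from the numerical radius: the
  defects of \<open>T\<close> and \<open>- T\<close> bound the norm of \<open>T\<close>, so defects
  also detect linear relations.\<close>

lemma scaleC_zero_right [simp]: "c *\<^sub>C 0 = (0 :: 'h :: chilbert_space)"
  using scaleC_add_right[of c 0 "0 :: 'h"] by simp

lemma cinner_add_right:
  "cinner x (y + z) = cinner x y + cinner x (z :: 'h :: chilbert_space)"
  by (metis cinner_add_left cinner_commute complex_cnj_add)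

lemma cinner_scaleC_right: "cinner x (c *\<^sub>C y) = cnj c * cinner x (y :: 'h :: chilbert_space)"
  by (metis cinner_commute cinner_scaleC_left complex_cnj_mult)

lemma Re_cinner_self: "Re (cinner x x) = (norm (x :: 'h :: chilbert_space))\<^sup>2"
  by (simp add: cinner_self)

lemma Re_cinner_commute: "Re (cinner y x) = Re (cinner x (y :: 'h :: chilbert_space))"
  using cinner_commute[of y x] by simp

lemma norm_add_sq:
  "(norm (x + y))\<^sup>2 = (norm x)\<^sup>2 + (norm y)\<^sup>2 + 2 * Re (cinner x (y :: 'h :: chilbert_space))"
  by (simp add: Re_cinner_self[symmetric] cinner_add_left cinner_add_right Re_cinner_commute)

lemma cinner_Cauchy_Schwarz: "cmod (cinner x y) \<le> norm x * norm (y :: 'h :: chilbert_space)"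
proof (cases "y = 0")
  case True
  then show ?thesis
    using cinner_scaleC_right[of x 0 y] by simp
next
  case False
  \<comment> \<open>With this \<open>c\<close> the vector \<open>x + c *\<^sub>C y\<close> is the
    component of \<open>x\<close> orthogonal to \<open>y\<close>; the inequality says that its
    squared norm is nonnegative.\<close>
  define c where "c = - cinner x y / of_real ((norm y)\<^sup>2)"
  have c: "cmod c = cmod (cinner x y) / (norm y)\<^sup>2"
    by (simp add: c_def norm_divide norm_power)
  have "cnj c * cinner x y = - of_real ((cmod (cinner x y))\<^sup>2 / (norm y)\<^sup>2)"
    using complex_norm_square[of "cinner x y"] by (simp add: c_def mult.commute)
  then have "Re (cinner x (c *\<^sub>C y)) = - (cmod (cinner x y))\<^sup>2 / (norm y)\<^sup>2"
    by (simp only: cinner_scaleC_right uminus_complex.sel Re_complex_of_real)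
  then have "(norm (x + c *\<^sub>C y))\<^sup>2 = (norm x)\<^sup>2 - (cmod (cinner x y))\<^sup>2 / (norm y)\<^sup>2"
  proof -
    have "(norm (c *\<^sub>C y))\<^sup>2 = (cmod (cinner x y))\<^sup>2 / (norm y)\<^sup>2"
      using False by (simp add: norm_scaleC c power2_eq_square)
    then show ?thesis
      using \<open>Re (cinner x (c *\<^sub>C y)) = _\<close> by (simp add: norm_add_sq)
  qed
  then have "(cmod (cinner x y))\<^sup>2 / (norm y)\<^sup>2 \<le> (norm x)\<^sup>2"
    using zero_le_power2[of "norm (x + c *\<^sub>C y)"] by linarith
  then have "(cmod (cinner x y))\<^sup>2 \<le> (norm x * norm y)\<^sup>2"
    using False by (simp add: pos_divide_le_eq power_mult_distrib)
  then show ?thesis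
    by (rule power2_le_imp_le) simp
qed

interpretation cinner: bounded_bilinear "cinner :: 'h :: chilbert_space \<Rightarrow> 'h \<Rightarrow> complex"
proof
  fix x x' y y' :: 'h and r :: real
  show "cinner (x + x') y = cinner x y + cinner x' y" by (rule cinner_add_left)
  show "cinner x (y + y') = cinner x y + cinner x y'" by (rule cinner_add_right)
  show "cinner (r *\<^sub>R x) y = r *\<^sub>R cinner x y"
    by (metis cinner_scaleC_left scaleC_of_real scaleR_conv_of_real)
  show "cinner x (r *\<^sub>R y) = r *\<^sub>R cinner x y"
    by (metis cinner_scaleC_right scaleC_of_real scaleR_conv_of_real complex_cnj_complex_of_real)
  show "\<exists>K. \<forall>a b. cmod (cinner a b) \<le> norm a * norm b * K"
    using cinner_Cauchy_Schwarz by (metis mult.right_neutral)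
qed

lemma cinner_eq_imp_eq:
  assumes "\<And>x. cinner x y = cinner x (z :: 'h :: chilbert_space)"
  shows "y = z"
proof -
  have "cinner (y - z) (y - z) = 0"
    using assms[of "y - z"] by (simp only: cinner.diff_right) simp
  then show ?thesis by (simp add: cinner_self)
qed

text \<open>The representing vector minimises \<open>\<parallel>z\<parallel>\<^sup>2 - 2 Re f(z)\<close>; by the parallelogram law
  every minimising sequence is Cauchy.\<close>

lemma Riesz_representation:
  fixes f :: "'h :: chilbert_space \<Rightarrow> complex"
  assumes f: "bounded_linear f" and fC: "\<And>c x. f (c *\<^sub>C x) = c * f x"
  obtains z where "\<And>x. f x = cinner x z"
proof -
  interpret f: bounded_linear f by (rule f)
  obtain K where K: "\<And>x. cmod (f x) \<le> norm x * K" "0 \<le> K"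
    using f.nonneg_bounded by blast
  define J where "J z = (norm z)\<^sup>2 - 2 * Re (f z)" for z
  have lower: "- K\<^sup>2 \<le> J z" for z
  proof -
    have "Re (f z) \<le> norm z * K" using K(1)[of z] complex_Re_le_cmod[of "f z"] by linarith
    moreover have "0 \<le> (norm z - K)\<^sup>2" by simp
    ultimately show ?thesis unfolding J_def power2_diff by (simp add: mult.commute)
  qed
  define m where "m = Inf (range J)"
  have bdd: "bdd_below (range J)" using lower by (intro bdd_belowI[of _ "- K\<^sup>2"]) auto
  have mle: "m \<le> J z" for z unfolding m_def using bdd by (simp add: cINF_lower)
  have "\<exists>z. J z < m + inverse (real (Suc n))" for n
    using cInf_lessD[of "range J" "m + inverse (real (Suc n))"] by (auto simp: m_def)
  then obtain s where s: "\<And>n. J (s n) < m + inverse (real (Suc n))" by metis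
  have par: "(norm (a - b))\<^sup>2 \<le> 2 * ((J a - m) + (J b - m))" for a b
  proof -
    have "J ((1/2) *\<^sub>R (a + b)) = (norm (a + b))\<^sup>2 / 4 - Re (f a) - Re (f b)"
      by (simp add: J_def f.scaleR f.add power_divide add_divide_distrib del: scaleR_add_right)
    moreover have "(norm (a + b))\<^sup>2 + (norm (a - b))\<^sup>2 = 2 * (norm a)\<^sup>2 + 2 * (norm b)\<^sup>2"
      using norm_add_sq[of a b] norm_add_sq[of a "- b"] by (simp add: cinner.minus_right)
    ultimately show ?thesis
      using mle[of "(1/2) *\<^sub>R (a + b)"] unfolding J_def by simp
  qed
  have "Cauchy s"
  proof (rule metric_CauchyI)
    fix e :: real assume "0 < e"
    then obtain N where N: "inverse (real (Suc N)) < e\<^sup>2 / 4"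
      using reals_Archimedean[of "e\<^sup>2 / 4"] by auto
    have "dist (s i) (s j) < e" if "N \<le> i" "N \<le> j" for i j
    proof -
      have "inverse (real (Suc i)) \<le> inverse (real (Suc N))"
        "inverse (real (Suc j)) \<le> inverse (real (Suc N))"
        using that by (auto intro!: le_imp_inverse_le)
      then have "J (s i) - m < e\<^sup>2 / 4" "J (s j) - m < e\<^sup>2 / 4"
        using s[of i] s[of j] N by argo+
      then have "(norm (s i - s j))\<^sup>2 < e\<^sup>2"
        using par[of "s i" "s j"] by argo
      then show ?thesis
        using \<open>0 < e\<close> by (simp add: dist_norm power2_less_imp_less)
    qed
    then show "\<exists>M. \<forall>i\<ge>M. \<forall>j\<ge>M. dist (s i) (s j) < e" by blast
  qed
  then obtain z where z: "s \<longlonglongrightarrow> z" using Cauchy_convergent convergent_def by blast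
  have "(\<lambda>n. J (s n)) \<longlonglongrightarrow> J z"
    unfolding J_def by (intro tendsto_intros f.tendsto z)
  moreover have "(\<lambda>n. m + inverse (real (Suc n))) \<longlonglongrightarrow> m + 0"
    by (intro tendsto_intros LIMSEQ_inverse_real_of_nat)
  ultimately have "J z \<le> m + 0"
    using s by (meson LIMSEQ_le less_imp_le)
  then have min: "J z \<le> J w" for w using mle[of w] by linarith
  have re: "Re (f x) = Re (cinner x z)" for x
  proof -
    define u where "u = Re (cinner z x) - Re (f x)"
    \<comment> \<open>\<open>u\<close> is half the derivative at 0 of \<open>J\<close> along
      \<open>x\<close>. The optimal step would be - u / (norm x)^2; adding 1 to the denominator
      keeps it nonzero when \<open>x = 0\<close> and still makes \<open>J\<close> decrease unless
      \<open>u = 0\<close>.\<close>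
    define S where "S = (norm x)\<^sup>2 + 1"
    have S: "0 < S" unfolding S_def by (simp add: add_nonneg_pos)
    define t where "t = - u / S"
    have "J (z + t *\<^sub>R x) = J z + 2 * t * u + t\<^sup>2 * (norm x)\<^sup>2"
      unfolding J_def u_def
      by (simp add: norm_add_sq f.add f.scaleR cinner.scaleR_right algebra_simps power_mult_distrib)
    then have "0 \<le> 2 * t * u + t\<^sup>2 * (norm x)\<^sup>2" using min[of "z + t *\<^sub>R x"] by linarith
    also have "\<dots> = u\<^sup>2 * (- S - 1) / S\<^sup>2"
    proof -
      have "t * S = - u" using S by (simp add: t_def)
      then have "(2 * t * u + t\<^sup>2 * (norm x)\<^sup>2) * S\<^sup>2 = u\<^sup>2 * (- S - 1)"
        by (simp add: S_def power2_eq_square) algebra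
      then show ?thesis using S by (simp add: field_simps)
    qed
    finally have "u\<^sup>2 * (S + 1) \<le> 0"
      using S by (simp add: divide_le_0_iff zero_le_divide_iff algebra_simps)
    then have "u = 0"
      using S by (simp add: mult_le_0_iff)
    then show ?thesis unfolding u_def using Re_cinner_commute[of x z] by simp
  qed
  have "f x = cinner x z" for x
  proof (rule complex_eqI)
    show "Re (f x) = Re (cinner x z)" by (rule re)
    show "Im (f x) = Im (cinner x z)"
      using re[of "\<i> *\<^sub>C x"] by (simp add: fC cinner_scaleC_left)
  qed
  then show ?thesis by (rule that)
qed

section \<open>Operator scalars and the closed subspace of complex-linear operators\<close>

interpretation op: vector_space "op_scaleC :: complex \<Rightarrow> 'h op \<Rightarrow> 'h :: chilbert_space op"
  by (rule vector_space_op_scaleC)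

lemma BH_D: "T \<in> BH \<Longrightarrow> blinfun_apply T (c *\<^sub>C x) = c *\<^sub>C blinfun_apply T x"
  by (simp add: BH_def)

lemma norm_op_scaleC: "norm (op_scaleC c T) = cmod c * norm T"
proof (cases "c = 0")
  case False
  have le: "norm (op_scaleC c T) \<le> cmod c * norm T" for c and T :: "'a op"
  proof (rule norm_blinfun_bound)
    show "norm (blinfun_apply (op_scaleC c T) x) \<le> cmod c * norm T * norm x" for x
      using norm_blinfun[of T x]
      by (simp add: op_scaleC.rep_eq norm_scaleC mult.assoc mult_left_mono)
  qed simp
  have "norm T \<le> cmod (inverse c) * norm (op_scaleC c T)"
    using le[of "inverse c" "op_scaleC c T"] False by simp
  then show ?thesis
    using False le[of c T] by (simp add: norm_divide norm_inverse field_simps)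
qed simp

text \<open>Provides joint continuity, for limits in which coefficients and operators vary
  together.\<close>

interpretation op_scale: bounded_bilinear
  "op_scaleC :: complex \<Rightarrow> 'h op \<Rightarrow> 'h :: chilbert_space op"
proof
  have R: "op_scaleC (of_real r) T = r *\<^sub>R T" for r and T :: "'h op"
    by (rule blinfun_eqI) (simp add: op_scaleC.rep_eq scaleC_of_real scaleR_blinfun.rep_eq)
  fix c c' :: complex and T T' :: "'h op" and r :: real
  show "op_scaleC (c + c') T = op_scaleC c T + op_scaleC c' T" by (rule op.scale_left_distrib)
  show "op_scaleC c (T + T') = op_scaleC c T + op_scaleC c T'" by (rule op.scale_right_distrib)
  show "op_scaleC (r *\<^sub>R c) T = r *\<^sub>R op_scaleC c T"
    by (simp add: R[symmetric] scaleR_conv_of_real)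
  show "op_scaleC c (r *\<^sub>R T) = r *\<^sub>R op_scaleC c T"
    by (simp add: R[symmetric] mult.commute)
  show "\<exists>K. \<forall>a b. norm (op_scaleC a (b :: 'h op)) \<le> norm a * norm b * K"
    by (intro exI[of _ 1]) (simp add: norm_op_scaleC)
qed

lemma subspace_BH: "op.subspace (BH :: 'h :: chilbert_space op set)"
proof (rule op.subspaceI)
  show "0 \<in> (BH :: 'h op set)"
    by (simp add: BH_def)
  show "S + T \<in> BH" if "S \<in> BH" "T \<in> BH" for S T :: "'h op"
    using that by (simp add: BH_def blinfun.add_left scaleC_add_right)
  show "op_scaleC c T \<in> BH" if "T \<in> BH" for c and T :: "'h op"
    using that by (simp add: BH_def op_scaleC.rep_eq scaleC_scaleC mult.commute)
qed

lemma id_in_BH: "id_blinfun \<in> BH"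
  by (simp add: BH_def id_blinfun.rep_eq)

text \<open>An intersection of equalisers of continuous maps. It keeps the closure taken in
  \<open>OSy\<close>, formed among real-linear operators, inside \<open>BH\<close>.\<close>

lemma closed_BH: "closed (BH :: 'h :: chilbert_space op set)"
proof -
  have sc: "bounded_linear (\<lambda>v :: 'h. c *\<^sub>C v)" for c
  proof -
    have "(\<lambda>v :: 'h. c *\<^sub>C v) = blinfun_apply (op_scaleC c id_blinfun)"
      by (simp add: fun_eq_iff op_scaleC.rep_eq)
    then show ?thesis by (simp add: blinfun.bounded_linear_right)
  qed
  have "closed {T :: 'h op. blinfun_apply T (c *\<^sub>C x) = c *\<^sub>C blinfun_apply T x}" for c x
    by (intro closed_Collect_eq bounded_linear.continuous_on[OF sc]
        bounded_linear.continuous_on[OF blinfun.bounded_linear_left] continuous_on_id)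
  then have "closed (\<Inter>c. \<Inter>x. {T :: 'h op. blinfun_apply T (c *\<^sub>C x) = c *\<^sub>C blinfun_apply T x})"
    by blast
  moreover have "(\<Inter>c. \<Inter>x. {T :: 'h op. blinfun_apply T (c *\<^sub>C x) = c *\<^sub>C blinfun_apply T x}) = BH"
    by (auto simp: BH_def)
  ultimately show ?thesis by simp
qed

section \<open>Adjoints\<close>

text \<open>Riesz represents each functional x -> <T x, y>; uniqueness of the representing vector
  makes it depend linearly on \<open>y\<close>, and testing against \<open>S y\<close> itself bounds
  it.\<close>

lemma adj_exists:
  fixes T :: "'h :: chilbert_space op"
  assumes T: "T \<in> BH"
  shows "\<exists>S. S \<in> BH \<and> (\<forall>x y. cinner (blinfun_apply T x) y = cinner x (blinfun_apply S y))"
proof -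
  have "\<exists>z. \<forall>x. cinner (blinfun_apply T x) y = cinner x z" for y
  proof -
    have "bounded_linear (\<lambda>x. cinner (blinfun_apply T x) y)"
      using bounded_linear_compose[OF cinner.bounded_linear_left blinfun.bounded_linear_right] .
    then show ?thesis
      by (rule Riesz_representation[of "\<lambda>x. cinner (blinfun_apply T x) y"])
        (auto simp: BH_D[OF T] cinner_scaleC_left)
  qed
  then obtain S where S: "\<And>x y. cinner (blinfun_apply T x) y = cinner x (S y)" by metis
  have add: "S (y + y') = S y + S y'" for y y'
    by (rule cinner_eq_imp_eq) (simp add: S[symmetric] cinner_add_right)
  have sc: "S (c *\<^sub>C y) = c *\<^sub>C S y" for c y
    by (rule cinner_eq_imp_eq) (simp add: S[symmetric] cinner_scaleC_right)
  have "bounded_linear S"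
  proof (rule bounded_linear_intro[where K = "norm T"])
    show "S (y + y') = S y + S y'" for y y' by (rule add)
    show "S (r *\<^sub>R y) = r *\<^sub>R S y" for r y
      using sc[of "of_real r" y] by (simp add: scaleC_of_real)
    show "norm (S y) \<le> norm y * norm T" for y
    proof -
      have "(norm (S y))\<^sup>2 = cmod (cinner (S y) (S y))"
        by (simp add: cinner_self norm_power)
      also have "\<dots> = cmod (cinner (blinfun_apply T (S y)) y)" by (simp add: S)
      also have "\<dots> \<le> norm (blinfun_apply T (S y)) * norm y" by (rule cinner_Cauchy_Schwarz)
      also have "\<dots> \<le> norm T * norm (S y) * norm y"
        by (intro mult_right_mono norm_blinfun) simp
      finally have "norm (S y) * norm (S y) \<le> norm (S y) * (norm y * norm T)"
        by (simp add: power2_eq_square algebra_simps)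
      then show ?thesis
        by (cases "norm (S y) = 0") (auto simp: mult_le_cancel_left)
    qed
  qed
  then have "blinfun_apply (Blinfun S) = S" by (rule bounded_linear_Blinfun_apply)
  then show ?thesis using S sc by (intro exI[of _ "Blinfun S"]) (simp add: BH_def)
qed

lemma
  fixes T :: "'h :: chilbert_space op"
  assumes "T \<in> BH"
  shows adj_in_BH: "adj T \<in> BH"
    and cinner_adj: "cinner (blinfun_apply T x) y = cinner x (blinfun_apply (adj T) y)"
proof -
  have "\<exists>!S. S \<in> BH \<and> (\<forall>x y. cinner (blinfun_apply T x) y = cinner x (blinfun_apply S y))"
  proof (rule ex_ex1I[OF adj_exists[OF assms]])
    fix S S' assume
      "S \<in> BH \<and> (\<forall>x y. cinner (blinfun_apply T x) y = cinner x (blinfun_apply S y))"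
      "S' \<in> BH \<and> (\<forall>x y. cinner (blinfun_apply T x) y = cinner x (blinfun_apply S' y))"
    then show "S = S'" by (intro blinfun_eqI cinner_eq_imp_eq) metis
  qed
  from theI'[OF this]
  have "adj T \<in> BH \<and> (\<forall>x y. cinner (blinfun_apply T x) y = cinner x (blinfun_apply (adj T) y))"
    unfolding adj_def .
  then show "adj T \<in> BH"
    "cinner (blinfun_apply T x) y = cinner x (blinfun_apply (adj T) y)" by auto
qed

text \<open>Since \<open>adj\<close> is a definite description, its algebraic rules are all proved
  by exhibiting an operator with the adjoint property.\<close>

lemma adj_unique:
  fixes S T :: "'h :: chilbert_space op"
  assumes "T \<in> BH" "\<And>x y. cinner (blinfun_apply T x) y = cinner x (blinfun_apply S y)"
  shows "adj T = S"
  using assms cinner_adj[OF assms(1)] by (intro blinfun_eqI cinner_eq_imp_eq) metis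

lemma cinner_adj_left:
  fixes T :: "'h :: chilbert_space op"
  assumes "T \<in> BH"
  shows "cinner (blinfun_apply (adj T) x) y = cnj (cinner (blinfun_apply T y) x)"
  using cinner_adj[OF assms] by (metis cinner_commute)

lemma adj_id: "adj (id_blinfun :: 'h :: chilbert_space op) = id_blinfun"
  by (rule adj_unique) (simp_all add: id_in_BH)

lemma adj_adj: "T \<in> BH \<Longrightarrow> adj (adj T) = (T :: 'h :: chilbert_space op)"
  by (rule adj_unique) (simp_all add: adj_in_BH cinner_adj_left cinner_commute[symmetric])

lemma adj_add:
  "S \<in> BH \<Longrightarrow> T \<in> BH \<Longrightarrow> adj (S + T) = adj S + adj (T :: 'h :: chilbert_space op)"
  by (rule adj_unique)
    (simp_all add: op.subspace_add[OF subspace_BH] blinfun.add_left cinner_add_left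
      cinner_add_right cinner_adj)

lemma adj_scale:
  "T \<in> BH \<Longrightarrow> adj (op_scaleC c T) = op_scaleC (cnj c) (adj (T :: 'h :: chilbert_space op))"
  by (rule adj_unique)
    (simp_all add: op.subspace_scale[OF subspace_BH] op_scaleC.rep_eq cinner_scaleC_left
      cinner_scaleC_right cinner_adj)

lemma norm_adj_le:
  fixes T :: "'h :: chilbert_space op"
  assumes "T \<in> BH"
  shows "norm (adj T) \<le> norm T"
proof (rule norm_blinfun_bound)
  fix y
  let ?w = "blinfun_apply (adj T) y"
  have "(norm ?w)\<^sup>2 = cmod (cinner (blinfun_apply T ?w) y)"
    using cinner_adj[OF assms, of ?w y] by (simp add: cinner_self norm_power)
  also have "\<dots> \<le> norm (blinfun_apply T ?w) * norm y" by (rule cinner_Cauchy_Schwarz)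
  also have "\<dots> \<le> norm T * norm ?w * norm y"
    by (intro mult_right_mono norm_blinfun) simp
  finally have "norm ?w * norm ?w \<le> norm ?w * (norm T * norm y)"
    by (simp add: power2_eq_square algebra_simps)
  then show "norm ?w \<le> norm T * norm y"
    by (cases "norm ?w = 0") (auto simp: mult_le_cancel_left)
qed simp

text \<open>Transfers closure under adjoints from the span of the generators to its norm
  closure.\<close>

lemma continuous_on_adj: "continuous_on BH (adj :: 'h :: chilbert_space op \<Rightarrow> 'h op)"
proof -
  have "dist (adj S) (adj T) \<le> dist S T" if "S \<in> BH" "T \<in> BH" for S T :: "'h op"
  proof -
    have "S - T \<in> BH" using that by (rule op.subspace_diff[OF subspace_BH])
    moreover have "adj (S - T) = adj S - adj T"
      using adj_add[of "S - T" T] calculation that by (simp add: algebra_simps)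
    ultimately show ?thesis using norm_adj_le[of "S - T"] by (simp add: dist_norm)
  qed
  then show ?thesis
    unfolding continuous_on_iff by (meson order_le_less_trans)
qed

section \<open>The defect of positivity of an operator matrix\<close>

text \<open>The body repeats the expression in \<open>mat_pos\<close>, so that positivity can be
  folded into a statement about this form.\<close>

definition mform :: "nat \<Rightarrow> (nat \<Rightarrow> nat \<Rightarrow> 'h :: chilbert_space op) \<Rightarrow> (nat \<Rightarrow> 'h) \<Rightarrow> complex" where
  "mform n a \<xi> = (\<Sum>i<n. cinner (\<Sum>j<n. blinfun_apply (a i j) (\<xi> j)) (\<xi> i))"

definition sqsum :: "nat \<Rightarrow> (nat \<Rightarrow> 'h :: real_normed_vector) \<Rightarrow> real" where
  "sqsum n \<xi> = (\<Sum>i<n. (norm (\<xi> i))\<^sup>2)"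

definition almost_pos :: "nat \<Rightarrow> (nat \<Rightarrow> nat \<Rightarrow> 'h :: chilbert_space op) \<Rightarrow> real \<Rightarrow> bool" where
  "almost_pos n a e \<longleftrightarrow>
     (\<forall>\<xi>. - Re (mform n a \<xi>) \<le> e * sqsum n \<xi> \<and> \<bar>Im (mform n a \<xi>)\<bar> \<le> e * sqsum n \<xi>)"

text \<open>The constraint \<open>0 \<le> e\<close> keeps the set bounded below when
  \<open>n = 0\<close>: there both sides of \<open>almost_pos\<close> vanish for every real
  \<open>e\<close>.\<close>

definition pos_defect :: "nat \<Rightarrow> (nat \<Rightarrow> nat \<Rightarrow> 'h :: chilbert_space op) \<Rightarrow> real" where
  "pos_defect n a = Inf {e. 0 \<le> e \<and> almost_pos n a e}"

lemma sqsum_nonneg: "0 \<le> sqsum n \<xi>"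
  by (simp add: sqsum_def sum_nonneg)

lemma mform_alt: "mform n a \<xi> = (\<Sum>i<n. \<Sum>j<n. cinner (blinfun_apply (a i j) (\<xi> j)) (\<xi> i))"
  by (simp add: mform_def cinner.sum_left)

lemma mform_add: "mform n (\<lambda>i j. a i j + b i j) \<xi> = mform n a \<xi> + mform n b \<xi>"
  by (simp add: mform_alt blinfun.add_left cinner_add_left sum.distrib)

lemma mform_scale: "mform n (\<lambda>i j. op_scaleC c (a i j)) \<xi> = c * mform n a \<xi>"
  by (simp add: mform_alt op_scaleC.rep_eq cinner_scaleC_left sum_distrib_left)

lemma mform_diff: "mform n (\<lambda>i j. a i j - b i j) \<xi> = mform n a \<xi> - mform n b \<xi>"
  using mform_add[of n "\<lambda>i j. a i j - b i j" b \<xi>] by simp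

lemma mform_cong:
  "(\<And>i j. i < n \<Longrightarrow> j < n \<Longrightarrow> a i j = b i j) \<Longrightarrow> mform n a \<xi> = mform n b \<xi>"
  by (simp add: mform_alt)

lemma almost_pos_cong:
  "(\<And>i j. i < n \<Longrightarrow> j < n \<Longrightarrow> a i j = b i j) \<Longrightarrow> almost_pos n a e = almost_pos n b e"
  unfolding almost_pos_def using mform_cong[of n a b] by simp

lemma pos_defect_cong:
  "(\<And>i j. i < n \<Longrightarrow> j < n \<Longrightarrow> a i j = b i j) \<Longrightarrow> pos_defect n a = pos_defect n b"
  unfolding pos_defect_def using almost_pos_cong[of n a b] by simp

lemma mat_pos_cong:
  "(\<And>i j. i < n \<Longrightarrow> j < n \<Longrightarrow> a i j = b i j) \<Longrightarrow> mat_pos n a = mat_pos n b"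
  unfolding mat_pos_def mform_def[symmetric] using mform_cong[of n a b] by simp

text \<open>Each product of two norms is at most \<open>sqsum n \<xi>\<close> by the
  arithmetic-geometric mean inequality. The crude sum of entry norms suffices, as only entrywise
  convergence is ever used.\<close>

lemma mform_bound:
  "cmod (mform n a \<xi>) \<le> (\<Sum>i<n. \<Sum>j<n. norm (a i j)) * sqsum n (\<xi> :: nat \<Rightarrow> 'h :: chilbert_space)"
proof -
  have le: "norm (\<xi> i) * norm (\<xi> j) \<le> sqsum n \<xi>" if "i < n" "j < n" for i j
  proof -
    have *: "(norm (\<xi> k))\<^sup>2 \<le> sqsum n \<xi>" if "k < n" for k
      unfolding sqsum_def using that by (intro member_le_sum) auto
    have "2 * (norm (\<xi> i) * norm (\<xi> j)) \<le> (norm (\<xi> i))\<^sup>2 + (norm (\<xi> j))\<^sup>2"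
      using sum_squares_bound[of "norm (\<xi> i)" "norm (\<xi> j)"] by simp
    then show ?thesis using *[OF that(1)] *[OF that(2)] by linarith
  qed
  have "cmod (mform n a \<xi>) \<le> (\<Sum>i<n. \<Sum>j<n. cmod (cinner (blinfun_apply (a i j) (\<xi> j)) (\<xi> i)))"
    unfolding mform_alt by (intro order_trans[OF norm_sum] sum_mono norm_sum)
  also have "\<dots> \<le> (\<Sum>i<n. \<Sum>j<n. norm (a i j) * sqsum n \<xi>)"
  proof (intro sum_mono)
    fix i j assume ij: "i \<in> {..<n}" "j \<in> {..<n}"
    have "cmod (cinner (blinfun_apply (a i j) (\<xi> j)) (\<xi> i))
        \<le> norm (a i j) * norm (\<xi> j) * norm (\<xi> i)"
      by (intro order_trans[OF cinner_Cauchy_Schwarz] mult_right_mono norm_blinfun) simp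
    also have "\<dots> \<le> norm (a i j) * sqsum n \<xi>"
      using le[of j i] ij by (simp add: mult.assoc mult_left_mono)
    finally show "cmod (cinner (blinfun_apply (a i j) (\<xi> j)) (\<xi> i)) \<le> norm (a i j) * sqsum n \<xi>" .
  qed
  finally show ?thesis by (simp add: sum_distrib_right)
qed

lemma almost_pos_perturb:
  assumes "almost_pos n a e"
  shows "almost_pos n b (e + (\<Sum>i<n. \<Sum>j<n. norm (a i j - b i j)))"
  unfolding almost_pos_def
proof (intro allI)
  fix \<xi> :: "nat \<Rightarrow> 'a"
  let ?s = "\<Sum>i<n. \<Sum>j<n. norm (a i j - b i j)"
  have "cmod (mform n a \<xi> - mform n b \<xi>) \<le> ?s * sqsum n \<xi>"
    using mform_bound[of n "\<lambda>i j. a i j - b i j" \<xi>] by (simp add: mform_diff)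
  then have "\<bar>Re (mform n a \<xi>) - Re (mform n b \<xi>)\<bar> \<le> ?s * sqsum n \<xi>"
    "\<bar>Im (mform n a \<xi>) - Im (mform n b \<xi>)\<bar> \<le> ?s * sqsum n \<xi>"
    using abs_Re_le_cmod[of "mform n a \<xi> - mform n b \<xi>"]
      abs_Im_le_cmod[of "mform n a \<xi> - mform n b \<xi>"] by auto
  then show "- Re (mform n b \<xi>) \<le> (e + ?s) * sqsum n \<xi> \<and> \<bar>Im (mform n b \<xi>)\<bar> \<le> (e + ?s) * sqsum n \<xi>"
    using assms[unfolded almost_pos_def, rule_format, of \<xi>] unfolding distrib_right by linarith
qed

lemma almost_pos_mono: "almost_pos n a e \<Longrightarrow> e \<le> e' \<Longrightarrow> almost_pos n a e'"
  unfolding almost_pos_def by (meson mult_right_mono order_trans sqsum_nonneg)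

lemma almost_pos_exists: "\<exists>e\<ge>0. almost_pos n a e"
proof -
  have "almost_pos n (\<lambda>i j. 0) 0" by (simp add: almost_pos_def mform_def cinner.zero_left)
  from almost_pos_perturb[OF this, of a] show ?thesis
    by (intro exI[of _ "\<Sum>i<n. \<Sum>j<n. norm (a i j)"]) (simp add: sum_nonneg)
qed

text \<open>The infimum is attained, because every vector imposes non-strict linear bounds on
  \<open>e\<close>. Comparing defects thereby becomes a statement about quadratic forms.\<close>

lemma pos_defect_le_iff:
  assumes "0 \<le> e"
  shows "pos_defect n a \<le> e \<longleftrightarrow> almost_pos n a e"
proof
  let ?S = "{e. 0 \<le> e \<and> almost_pos n a e}"
  have bdd: "bdd_below ?S" by (auto intro: bdd_belowI[of _ 0])
  show "pos_defect n a \<le> e" if "almost_pos n a e"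
    unfolding pos_defect_def using that assms by (intro cInf_lower bdd) simp
  assume le: "pos_defect n a \<le> e"
  have *: "almost_pos n a (e + \<delta>)" if "0 < \<delta>" for \<delta>
  proof -
    have "Inf ?S < e + \<delta>" using le that unfolding pos_defect_def by linarith
    moreover have "?S \<noteq> {}" using almost_pos_exists[of n a] by auto
    ultimately obtain e' where "e' \<in> ?S" "e' < e + \<delta>" using cInf_lessD by meson
    then show ?thesis using almost_pos_mono[of n a e' "e + \<delta>"] by simp
  qed
  have lim: "x \<le> e * s" if "\<And>\<delta>. 0 < \<delta> \<Longrightarrow> x \<le> (e + \<delta>) * s" "0 \<le> s" for x s :: real
  proof (rule field_le_epsilon)
    fix d :: real assume "0 < d"
    \<comment> \<open>Dividing by \<open>s + 1\<close> instead of \<open>s\<close> covers the case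
      \<open>s = 0\<close>.\<close>
    have "x \<le> (e + d / (s + 1)) * s" using that \<open>0 < d\<close> by simp
    also have "\<dots> = e * s + d * (s / (s + 1))" by (simp add: algebra_simps)
    also have "\<dots> \<le> e * s + d * 1"
      using \<open>0 < d\<close> \<open>0 \<le> s\<close> by (intro add_left_mono mult_left_mono) auto
    finally show "x \<le> e * s + d" by simp
  qed
  show "almost_pos n a e"
    unfolding almost_pos_def
    using *[unfolded almost_pos_def, rule_format] sqsum_nonneg by (intro allI conjI lim) auto
qed

lemma pos_defect_nonneg: "0 \<le> pos_defect n a"
  unfolding pos_defect_def using almost_pos_exists[of n a] by (intro cInf_greatest) auto

lemma almost_pos_pos_defect: "almost_pos n a (pos_defect n a)"
  using pos_defect_le_iff[OF pos_defect_nonneg] by blast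

lemma mat_pos_iff_pos_defect: "mat_pos n a \<longleftrightarrow> pos_defect n a = 0"
proof -
  have "pos_defect n a = 0 \<longleftrightarrow> almost_pos n a 0"
    using pos_defect_le_iff[of 0 n a] pos_defect_nonneg[of n a] by auto
  then show ?thesis
    by (auto simp: mat_pos_def almost_pos_def mform_def[symmetric] complex_nonneg_Reals_iff)
qed

lemma pos_defect_Lipschitz:
  "\<bar>pos_defect n a - pos_defect n b\<bar> \<le> (\<Sum>i<n. \<Sum>j<n. norm (a i j - b i j))"
proof -
  have *: "pos_defect n b \<le> pos_defect n a + (\<Sum>i<n. \<Sum>j<n. norm (a i j - b i j))"
    for a b :: "nat \<Rightarrow> nat \<Rightarrow> 'a op"
    using almost_pos_perturb[OF almost_pos_pos_defect] pos_defect_nonneg[of n a]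
    by (subst pos_defect_le_iff) (auto intro!: add_nonneg_nonneg sum_nonneg)
  show ?thesis
    using *[of a b] *[of b a] by (simp add: norm_minus_commute)
qed

lemma tendsto_pos_defect:
  assumes "\<And>i j. i < n \<Longrightarrow> j < n \<Longrightarrow> ((\<lambda>m. a m i j) \<longlongrightarrow> b i j) F"
  shows "((\<lambda>m. pos_defect n (a m)) \<longlongrightarrow> pos_defect n b) F"
proof (rule LIM_zero_cancel, rule Lim_null_comparison)
  show "\<forall>\<^sub>F m in F. norm (pos_defect n (a m) - pos_defect n b)
      \<le> (\<Sum>i<n. \<Sum>j<n. norm (a m i j - b i j))"
    by (simp add: pos_defect_Lipschitz)
  show "((\<lambda>m. \<Sum>i<n. \<Sum>j<n. norm (a m i j - b i j)) \<longlongrightarrow> 0) F"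
    using assms by (intro tendsto_null_sum tendsto_norm_zero LIM_zero) auto
qed

section \<open>The defect controls the operator norm\<close>

lemma polarization:
  fixes T :: "'h :: chilbert_space op"
  assumes "T \<in> BH"
  defines "Q z \<equiv> cinner (blinfun_apply T z) z"
  shows "4 * cinner (blinfun_apply T x) y =
    Q (x + y) - Q (x - y) + \<i> * Q (x + \<i> *\<^sub>C y) - \<i> * Q (x - \<i> *\<^sub>C y)"
  unfolding Q_def
  by (simp add: blinfun.add_right blinfun.diff_right cinner_add_left cinner_add_right
      cinner.diff_left cinner.diff_right BH_D[OF assms(1)] cinner_scaleC_left cinner_scaleC_right
      algebra_simps)

lemma mform_one: "mform 1 (\<lambda>i j. T) \<xi> = cinner (blinfun_apply T (\<xi> 0)) (\<xi> 0)"
  by (simp add: mform_def)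

text \<open>A numerical radius estimate. The defects of \<open>T\<close> and \<open>- T\<close>
  bound the real and imaginary parts of the quadratic form, hence the factor 2; polarization and the
  parallelogram law contribute another 2.\<close>

lemma norm_le_pos_defect:
  fixes T :: "'h :: chilbert_space op"
  assumes "T \<in> BH"
  shows "norm T \<le> 4 * (pos_defect 1 (\<lambda>i j. T) + pos_defect 1 (\<lambda>i j. - T))"
proof -
  define e where "e = pos_defect 1 (\<lambda>i j. T) + pos_defect 1 (\<lambda>i j. - T)"
  have "0 \<le> e" by (simp add: e_def pos_defect_nonneg)
  have "almost_pos 1 (\<lambda>i j. T) e" "almost_pos 1 (\<lambda>i j. - T) e"
    using \<open>0 \<le> e\<close> by (simp_all add: pos_defect_le_iff[symmetric] e_def pos_defect_nonneg)
  then have "cmod (cinner (blinfun_apply T z) z) \<le> 2 * e * (norm z)\<^sup>2" for z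
    using cmod_le[of "cinner (blinfun_apply T z) z"]
    unfolding almost_pos_def mform_one sqsum_def
    by (auto dest!: spec[of _ "\<lambda>_. z"] simp: blinfun.minus_left cinner.minus_left)
  note Q = this
  have bound: "cmod (cinner (blinfun_apply T x) y) \<le> 2 * e * ((norm x)\<^sup>2 + (norm y)\<^sup>2)" for x y
  proof -
    have par: "(norm (x + w))\<^sup>2 + (norm (x - w))\<^sup>2 = 2 * ((norm x)\<^sup>2 + (norm w)\<^sup>2)" for w
      using norm_add_sq[of x w] norm_add_sq[of x "- w"] by (simp add: cinner.minus_right)
    let ?q = "\<lambda>z. cmod (cinner (blinfun_apply T z) z)"
    have "4 * cmod (cinner (blinfun_apply T x) y) = cmod (4 * cinner (blinfun_apply T x) y)"
      by (simp add: norm_mult)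
    also have "\<dots> \<le> ?q (x + y) + ?q (x - y) + ?q (x + \<i> *\<^sub>C y) + ?q (x - \<i> *\<^sub>C y)"
      unfolding polarization[OF assms]
      by (intro order_trans[OF norm_triangle_ineq4] order_trans[OF norm_triangle_ineq] add_mono)
        (simp_all add: norm_mult)
    also have "\<dots> \<le> 2 * e * ((norm (x + y))\<^sup>2 + (norm (x - y))\<^sup>2
        + ((norm (x + \<i> *\<^sub>C y))\<^sup>2 + (norm (x - \<i> *\<^sub>C y))\<^sup>2))"
      using Q[of "x + y"] Q[of "x - y"] Q[of "x + \<i> *\<^sub>C y"] Q[of "x - \<i> *\<^sub>C y"]
      by (simp add: distrib_left)
    also have "\<dots> = 4 * (2 * e * ((norm x)\<^sup>2 + (norm y)\<^sup>2))"
      unfolding par by (simp add: norm_scaleC algebra_simps)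
    finally show ?thesis by simp
  qed
  have "norm T \<le> 4 * e"
  proof (rule norm_blinfun_bound)
    fix x
    let ?w = "blinfun_apply T x"
    show "norm ?w \<le> 4 * e * norm x"
    proof (cases "?w = 0 \<or> x = 0")
      case True
      then show ?thesis using \<open>0 \<le> e\<close> by auto
    next
      case False
      \<comment> \<open>The vector \<open>T x\<close> rescaled to the length of \<open>x\<close>, so
        that \<open>bound\<close> becomes quadratic in \<open>norm x\<close> alone.\<close>
      define y where "y = (norm x / norm ?w) *\<^sub>R ?w"
      have "cmod (cinner ?w y) = norm x * norm ?w"
        using False by (simp add: y_def cinner.scaleR_right cinner_self norm_power norm_mult power2_eq_square)
      moreover have "norm y = norm x" using False by (simp add: y_def)
      ultimately have "norm x * norm ?w \<le> norm x * (4 * e * norm x)"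
        using bound[of x y] by (simp add: power2_eq_square algebra_simps)
      then show ?thesis using False by simp
    qed
  qed (use \<open>0 \<le> e\<close> in simp)
  then show ?thesis by (simp add: e_def)
qed

text \<open>By continuity in the vector. Extensional functions into \<open>D\<close> are used
  because they form a countable set when \<open>D\<close> is countable, which makes the condition a
  countable intersection.\<close>

lemma almost_pos_dense:
  fixes D :: "'h :: chilbert_space set"
  assumes D: "closure D = UNIV"
  shows "almost_pos n a e \<longleftrightarrow> (\<forall>\<xi> \<in> {..<n} \<rightarrow>\<^sub>E D.
    - Re (mform n a \<xi>) \<le> e * sqsum n \<xi> \<and> \<bar>Im (mform n a \<xi>)\<bar> \<le> e * sqsum n \<xi>)"
    (is "_ \<longleftrightarrow> (\<forall>\<xi> \<in> _. ?P \<xi>)")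
proof
  assume *: "\<forall>\<xi> \<in> {..<n} \<rightarrow>\<^sub>E D. ?P \<xi>"
  show "almost_pos n a e"
    unfolding almost_pos_def
  proof
    fix \<xi> :: "nat \<Rightarrow> 'h"
    have "\<forall>i. \<exists>s. (\<forall>m. s m \<in> D) \<and> s \<longlonglongrightarrow> \<xi> i"
      using D closure_sequential[of _ D] by auto
    then obtain s where s: "\<And>i m. s i m \<in> D" "\<And>i. s i \<longlonglongrightarrow> \<xi> i" by metis
    define \<eta> where "\<eta> m = restrict (\<lambda>i. s i m) {..<n}" for m
    have \<eta>: "(\<lambda>m. \<eta> m i) \<longlonglongrightarrow> \<xi> i" if "i < n" for i
      using s(2)[of i] that by (simp add: \<eta>_def)
    have "\<eta> m \<in> {..<n} \<rightarrow>\<^sub>E D" for m using s(1) by (auto simp: \<eta>_def)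
    then have P: "?P (\<eta> m)" for m using * by blast
    have f: "(\<lambda>m. mform n a (\<eta> m)) \<longlonglongrightarrow> mform n a \<xi>"
      unfolding mform_def
      by (intro tendsto_sum cinner.tendsto blinfun.tendsto tendsto_const \<eta>) auto
    have g: "(\<lambda>m. e * sqsum n (\<eta> m)) \<longlonglongrightarrow> e * sqsum n \<xi>"
      unfolding sqsum_def by (intro tendsto_intros \<eta>) auto
    show "?P \<xi>"
    proof
      show "- Re (mform n a \<xi>) \<le> e * sqsum n \<xi>"
        using P by (intro LIMSEQ_le[OF tendsto_minus[OF tendsto_Re[OF f]] g]) auto
      show "\<bar>Im (mform n a \<xi>)\<bar> \<le> e * sqsum n \<xi>"
        using P by (intro LIMSEQ_le[OF tendsto_rabs[OF tendsto_Im[OF f]] g]) auto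
    qed
  qed
qed (simp add: almost_pos_def)

section \<open>Finite-dimensional spaces of operators\<close>

text \<open>Adjoining a vector \<open>b\<close> to a span preserves relative compactness of bounded sets, since
  \<open>b\<close> has positive distance from the smaller span and so the coefficients of \<open>b\<close> stay bounded.\<close>

lemma span_bounded_seq:
  fixes B :: "'h :: chilbert_space op set" and s :: "nat \<Rightarrow> 'h op"
  assumes "finite B" "\<And>k. s k \<in> op.span B" "bounded (range s)"
  shows "\<exists>l\<in>op.span B. \<exists>r. strict_mono (r :: nat \<Rightarrow> nat) \<and> (\<lambda>k. s (r k)) \<longlonglongrightarrow> l"
  using assms
proof (induction B arbitrary: s rule: finite_induct)
  case empty
  then have "s = (\<lambda>_. 0)" by (auto simp: op.span_empty)
  then show ?case by (auto simp: op.span_empty intro: exI[of _ id] strict_mono_id)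
next
  case (insert b B)
  show ?case
  proof (cases "b \<in> op.span B")
    case True
    then show ?thesis using insert by (simp add: op.span_redundant)
  next
    case False
    \<comment> \<open>Otherwise some sequence in the smaller span tends to \<open>b\<close>; the
      induction hypothesis gives a subsequence with limit in that span, contradicting
      \<open>b \<notin> op.span B\<close>.\<close>
    have "\<exists>\<delta>>0. \<forall>v\<in>op.span B. \<delta> \<le> norm (b - v)"
    proof (rule ccontr)
      assume neg: "\<not> ?thesis"
      have "\<exists>v\<in>op.span B. norm (b - v) < inverse (real (Suc n))" for n
        using neg by (meson inverse_positive_iff_positive not_le of_nat_0_less_iff zero_less_Suc)
      then obtain v where v: "\<And>n. v n \<in> op.span B"
        "\<And>n. norm (b - v n) < inverse (real (Suc n))" by metis
      have lim: "v \<longlonglongrightarrow> b"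
      proof (rule LIM_zero_cancel, rule Lim_null_comparison)
        show "\<forall>\<^sub>F n in sequentially. norm (v n - b) \<le> inverse (real (Suc n))"
          using v(2) by (intro always_eventually allI) (metis norm_minus_commute less_imp_le)
      qed (rule LIMSEQ_inverse_real_of_nat)
      then have "bounded (range v)" by (rule convergent_imp_bounded)
      with insert.IH[of v] v(1) obtain l r where l: "l \<in> op.span B" "strict_mono (r :: nat \<Rightarrow> nat)"
        "(\<lambda>k. v (r k)) \<longlonglongrightarrow> l" by blast
      have "(\<lambda>k. v (r k)) \<longlonglongrightarrow> b"
        using LIMSEQ_subseq_LIMSEQ[OF lim l(2)] by (simp add: o_def)
      then have "b = l" using l(3) LIMSEQ_unique by blast
      then show False using l(1) False by simp
    qed
    then obtain \<delta> where \<delta>: "0 < \<delta>" "\<And>v. v \<in> op.span B \<Longrightarrow> \<delta> \<le> norm (b - v)" by blast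
    have "\<exists>c. s k - op_scaleC c b \<in> op.span B" for k
      using insert.prems(1)[of k] by (simp add: op.span_breakdown_eq)
    then obtain c where c: "\<And>k. s k - op_scaleC (c k) b \<in> op.span B" by metis
    have cb: "cmod (c k) * \<delta> \<le> norm (s k)" for k
    proof (cases "c k = 0")
      case False
      \<comment> \<open>Chosen so that \<open>s k\<close> equals
        \<open>op_scaleC (c k) (b - v)\<close>, which turns the distance \<open>\<delta>\<close>
        into a bound on \<open>c k\<close>.\<close>
      define v where "v = op_scaleC (- inverse (c k)) (s k - op_scaleC (c k) b)"
      have "v \<in> op.span B" unfolding v_def by (rule op.span_scale[OF c])
      have "op_scaleC (c k) (b - v) = s k"
        using False by (simp add: v_def op.scale_right_diff_distrib)
      then have "norm (s k) = cmod (c k) * norm (b - v)" by (metis norm_op_scaleC)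
      then show ?thesis using \<delta>(2)[OF \<open>v \<in> op.span B\<close>] by (simp add: mult_left_mono)
    qed simp
    obtain M where M: "\<And>k. norm (s k) \<le> M"
      using insert.prems(2) by (auto simp: bounded_iff)
    have cM: "cmod (c k) \<le> M / \<delta>" for k
      using order_trans[OF cb M] \<delta>(1) by (simp add: pos_le_divide_eq)
    then have "bounded (range c)" by (auto simp: bounded_iff)
    then obtain l r where r: "strict_mono (r :: nat \<Rightarrow> nat)" "(\<lambda>k. c (r k)) \<longlonglongrightarrow> l"
      using bounded_imp_convergent_subsequence[of c] by (auto simp: o_def)
    define u where "u k = s (r k) - op_scaleC (c (r k)) b" for k
    have "norm (u k) \<le> M + M / \<delta> * norm b" for k
      unfolding u_def
      by (intro order_trans[OF norm_triangle_ineq4] add_mono M)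
        (simp only: norm_op_scaleC mult_right_mono[OF cM norm_ge_zero])
    then have "bounded (range u)" by (auto simp: bounded_iff)
    moreover have "u k \<in> op.span B" for k unfolding u_def by (rule c)
    ultimately obtain l' r' where l': "l' \<in> op.span B" "strict_mono (r' :: nat \<Rightarrow> nat)"
      "(\<lambda>k. u (r' k)) \<longlonglongrightarrow> l'" using insert.IH by blast
    have "(\<lambda>k. c (r (r' k))) \<longlonglongrightarrow> l"
      using LIMSEQ_subseq_LIMSEQ[OF r(2) l'(2)] by (simp add: o_def)
    then have "(\<lambda>k. u (r' k) + op_scaleC (c (r (r' k))) b) \<longlonglongrightarrow> l' + op_scaleC l b"
      by (intro tendsto_add l'(3) op_scale.tendsto tendsto_const)
    then have "(\<lambda>k. s ((r \<circ> r') k)) \<longlonglongrightarrow> l' + op_scaleC l b" by (simp add: u_def)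
    moreover have "l' + op_scaleC l b \<in> op.span (insert b B)"
      using l'(1) by (auto simp: op.span_breakdown_eq intro: exI[of _ l])
    moreover have "strict_mono (r \<circ> r')" using r(1) l'(2) by (rule strict_mono_o)
    ultimately show ?thesis by blast
  qed
qed

text \<open>Subsequences are extracted one coordinate at a time; passing to a further subsequence
  preserves the limits already obtained.\<close>

lemma fin_dim_bounded_tuple_seq:
  fixes X :: "'h :: chilbert_space op set" and y :: "nat \<Rightarrow> nat \<Rightarrow> 'h op"
  assumes X: "fin_dim op_scaleC X"
    and "\<And>k i. i < d \<Longrightarrow> y k i \<in> X" "\<And>i. i < d \<Longrightarrow> bounded (range (\<lambda>k. y k i))"
  shows "\<exists>r l. strict_mono (r :: nat \<Rightarrow> nat) \<and> (\<forall>i<d. l i \<in> X \<and> (\<lambda>k. y (r k) i) \<longlonglongrightarrow> l i)"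
  using assms(2,3)
proof (induction d)
  case 0
  then show ?case by (auto intro: exI[of _ id] strict_mono_id)
next
  case (Suc d)
  then obtain r l where r: "strict_mono (r :: nat \<Rightarrow> nat)"
    "\<And>i. i < d \<Longrightarrow> l i \<in> X \<and> (\<lambda>k. y (r k) i) \<longlonglongrightarrow> l i" by (metis less_SucI)
  obtain B where B: "finite B" "op.span B = X" using X by (auto simp: fin_dim_def)
  have "bounded (range (\<lambda>k. y (r k) d))"
    using bounded_subset[OF Suc.prems(2)[OF lessI]] by (auto simp: image_subset_iff)
  then obtain l' r' where l': "l' \<in> X" "strict_mono (r' :: nat \<Rightarrow> nat)"
    "(\<lambda>k. y (r (r' k)) d) \<longlonglongrightarrow> l'"
    using span_bounded_seq[OF B(1), of "\<lambda>k. y (r k) d"] Suc.prems(1)[OF lessI] B(2) by blast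
  have "strict_mono (r \<circ> r')" using r(1) l'(2) by (rule strict_mono_o)
  moreover have "(l(d := l')) i \<in> X \<and> (\<lambda>k. y ((r \<circ> r') k) i) \<longlonglongrightarrow> (l(d := l')) i"
    if "i < Suc d" for i
  proof (cases "i = d")
    case False
    then have "i < d" using that by simp
    from LIMSEQ_subseq_LIMSEQ[OF conjunct2[OF r(2)[OF this]] l'(2)] r(2)[OF this] False
    show ?thesis by (simp add: o_def)
  qed (use l' in simp)
  ultimately show ?case by blast
qed

section \<open>Linear maps on subspaces and dimension counting\<close>

text \<open>Linearity relative to a set, because \<open>ucp\<close> constrains a map only on its
  domain system and leaves its other values arbitrary.\<close>

definition op_linear_on :: "'h :: chilbert_space op set \<Rightarrow> ('h op \<Rightarrow> 'h op) \<Rightarrow> bool" where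
  "op_linear_on X \<phi> \<longleftrightarrow> (\<forall>x\<in>X. \<forall>y\<in>X. \<phi> (x + y) = \<phi> x + \<phi> y) \<and>
     (\<forall>c. \<forall>x\<in>X. \<phi> (op_scaleC c x) = op_scaleC c (\<phi> x))"

lemma op_linear_on_sum:
  assumes \<phi>: "op_linear_on X \<phi>" and X: "op.subspace X" and "finite I" "\<And>i. i \<in> I \<Longrightarrow> x i \<in> X"
  shows "\<phi> (\<Sum>i\<in>I. op_scaleC (c i) (x i)) = (\<Sum>i\<in>I. op_scaleC (c i) (\<phi> (x i)))"
  using assms(3,4)
proof (induction I rule: finite_induct)
  case empty
  have "\<phi> (op_scaleC 0 0) = op_scaleC 0 (\<phi> 0)"
    using \<phi> op.subspace_0[OF X] unfolding op_linear_on_def by blast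
  then show ?case by simp
next
  case (insert i I)
  have "(\<Sum>i\<in>I. op_scaleC (c i) (x i)) \<in> X" "op_scaleC (c i) (x i) \<in> X" "x i \<in> X"
    using insert by (auto intro!: op.subspace_sum[OF X] op.subspace_scale[OF X])
  then show ?case using insert \<phi> by (simp add: op_linear_on_def)
qed

text \<open>As \<open>\<phi>\<close> is linear only on the span, it is exchanged for a globally
  linear \<open>g\<close> that extends its values on \<open>B\<close> and agrees with it on the
  span.\<close>

lemma independent_image:
  fixes B :: "'h :: chilbert_space op set"
  assumes B: "op.independent B" and \<phi>: "op_linear_on (op.span B) \<phi>" "inj_on \<phi> (op.span B)"
  shows "op.independent (\<phi> ` B) \<and> op.span (\<phi> ` B) = \<phi> ` op.span B"
proof -
  interpret p: vector_space_pair "op_scaleC :: complex \<Rightarrow> 'h op \<Rightarrow> 'h op" op_scaleC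
    by unfold_locales
  obtain g where g: "Vector_Spaces.linear op_scaleC op_scaleC g" "\<And>x. x \<in> B \<Longrightarrow> g x = \<phi> x"
    using p.linear_independent_extend[OF B] by blast
  interpret g: Vector_Spaces.linear op_scaleC op_scaleC g by (rule g(1))
  have eq: "g x = \<phi> x" if "x \<in> op.span B" for x
  proof -
    have "x \<in> op.span B \<and> g x = \<phi> x"
      using that
    proof (induction rule: op.span_induct_alt)
      case base
      have "\<phi> (op_scaleC 0 0) = op_scaleC 0 (\<phi> 0)"
        using \<phi>(1) op.span_zero unfolding op_linear_on_def by blast
      then show ?case by (simp add: op.span_zero g.zero)
    next
      case (step c x y)
      then have "op_scaleC c x \<in> op.span B" "x \<in> op.span B"
        by (simp_all add: op.span_base op.span_scale)
      then show ?case
        using step \<phi>(1) g(2) by (simp add: op.span_add op_linear_on_def g.add g.scale)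
    qed
    then show ?thesis by blast
  qed
  have "g ` B = \<phi> ` B" using g(2) by (auto simp: image_iff)
  moreover have "g ` op.span B = \<phi> ` op.span B" using eq by (auto simp: image_iff)
  moreover have "inj_on g (op.span B)" using \<phi>(2) eq by (simp cong: inj_on_cong)
  ultimately show ?thesis
    using p.linear_independent_injective_image[OF g(1) B] g.span_image by metis
qed

lemma fin_dim_basis:
  fixes X :: "'h :: chilbert_space op set"
  assumes "fin_dim op_scaleC X"
  obtains B where "finite B" "op.independent B" "op.span B = X"
proof -
  obtain F where F: "finite F" "op.span F = X" using assms by (auto simp: fin_dim_def)
  obtain B where B: "B \<subseteq> X" "op.independent B" "X \<subseteq> op.span B"
    using op.maximal_independent_subset by blast
  have "op.span B \<subseteq> X" using B(1) F(2) op.span_minimal op.subspace_span by metis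
  moreover have "finite B"
    using op.independent_span_bound[OF F(1) B(2)] B(1) F(2) by blast
  ultimately show ?thesis using that B by blast
qed

text \<open>The map \<open>\<psi>\<close> serves to show that the dimension of \<open>Y\<close> is
  at most that of \<open>X\<close>. A vector of \<open>Y\<close> outside the image of
  \<open>\<phi>\<close> could then be adjoined to the image of a basis, giving too many independent
  vectors in \<open>Y\<close>.\<close>

lemma fin_dim_mutual_injections:
  fixes X Y :: "'h :: chilbert_space op set"
  assumes X: "fin_dim op_scaleC X" and Y: "fin_dim op_scaleC Y"
    and \<phi>: "op_linear_on X \<phi>" "inj_on \<phi> X" "\<phi> ` X \<subseteq> Y"
    and \<psi>: "op_linear_on Y \<psi>" "inj_on \<psi> Y" "\<psi> ` Y \<subseteq> X"
  shows "\<phi> ` X = Y"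
proof -
  obtain B where B: "finite B" "op.independent B" "op.span B = X" using fin_dim_basis[OF X] .
  obtain C where C: "finite C" "op.independent C" "op.span C = Y" using fin_dim_basis[OF Y] .
  have iB: "op.independent (\<phi> ` B)" "op.span (\<phi> ` B) = \<phi> ` X"
    using independent_image[of B \<phi>] B \<phi> by auto
  have iC: "op.independent (\<psi> ` C)" using independent_image[of C \<psi>] C \<psi> by auto
  have subs: "B \<subseteq> X" "C \<subseteq> Y" using B(3) C(3) op.span_superset by blast+
  have "\<psi> ` C \<subseteq> op.span B" using subs \<psi>(3) B(3) by blast
  then have "card (\<psi> ` C) \<le> card B" using op.independent_span_bound[OF B(1) iC] by blast
  moreover have "card (\<psi> ` C) = card C" "card (\<phi> ` B) = card B"
    using subs \<psi>(2) \<phi>(2) by (auto intro!: card_image intro: inj_on_subset)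
  ultimately have le: "card C \<le> card (\<phi> ` B)" by simp
  have "v \<in> \<phi> ` X" if "v \<in> Y" for v
  proof (rule ccontr)
    assume "v \<notin> \<phi> ` X"
    then have "op.independent (insert v (\<phi> ` B))" "v \<notin> \<phi> ` B"
      using op.independent_insertI[OF _ iB(1)] iB(2) op.span_base[of v "\<phi> ` B"] by auto
    moreover have "insert v (\<phi> ` B) \<subseteq> op.span C" using that subs \<phi>(3) C(3) by blast
    ultimately have "Suc (card (\<phi> ` B)) \<le> card C"
      using op.independent_span_bound[OF C(1), of "insert v (\<phi> ` B)"] B(1) by simp
    then show False using le by simp
  qed
  then show ?thesis using \<phi>(3) by blast
qed

section \<open>Operator systems\<close>

definition operator_system :: "'h :: chilbert_space op set \<Rightarrow> bool" where
  "operator_system X \<longleftrightarrow> X \<subseteq> BH \<and> op.subspace X \<and> id_blinfun \<in> X \<and> adj ` X \<subseteq> X"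

definition OSy_gens :: "(nat \<Rightarrow> 'h op) \<Rightarrow> 'h :: chilbert_space op set" where
  "OSy_gens \<gamma> = {id_blinfun} \<union> range \<gamma> \<union> adj ` range \<gamma>"

lemma OSy_alt: "OSy \<gamma> = closure (op.span (OSy_gens \<gamma>))"
  by (simp add: OSy_def OSy_gens_def)

lemma op_subspace_closure:
  fixes S :: "'h :: chilbert_space op set"
  assumes S: "op.subspace S"
  shows "op.subspace (closure S)"
proof (rule op.subspaceI)
  show "0 \<in> closure S" using op.subspace_0[OF S] closure_subset by blast
  show "x + y \<in> closure S" if "x \<in> closure S" "y \<in> closure S" for x y
  proof -
    from that obtain s t where "\<And>n. s n \<in> S" "s \<longlonglongrightarrow> x" "\<And>n. t n \<in> S" "t \<longlonglongrightarrow> y"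
      unfolding closure_sequential by blast
    then show ?thesis
      unfolding closure_sequential
      by (intro exI[of _ "\<lambda>n. s n + t n"]) (auto intro: op.subspace_add[OF S] tendsto_add)
  qed
  show "op_scaleC c x \<in> closure S" if "x \<in> closure S" for c x
  proof -
    from that obtain s where "\<And>n. s n \<in> S" "s \<longlonglongrightarrow> x"
      unfolding closure_sequential by blast
    then show ?thesis
      unfolding closure_sequential
      by (intro exI[of _ "\<lambda>n. op_scaleC c (s n)"])
        (auto intro: op.subspace_scale[OF S] op_scale.tendsto)
  qed
qed

lemma OSy_gens_BH:
  assumes "\<And>n. \<gamma> n \<in> BH"
  shows "OSy_gens \<gamma> \<subseteq> BH"
  using assms by (auto simp: OSy_gens_def id_in_BH adj_in_BH)

lemma adj_OSy_gens:
  assumes "\<And>n. \<gamma> n \<in> BH" "g \<in> OSy_gens \<gamma>"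
  shows "adj g \<in> OSy_gens \<gamma>"
  using assms by (auto simp: OSy_gens_def adj_id adj_adj)

lemma operator_system_OSy:
  fixes \<gamma> :: "nat \<Rightarrow> 'h :: chilbert_space op"
  assumes \<gamma>: "\<And>n. \<gamma> n \<in> BH"
  shows "operator_system (OSy \<gamma>)"
  unfolding operator_system_def
proof (intro conjI)
  let ?S = "op.span (OSy_gens \<gamma>)"
  have SB: "?S \<subseteq> BH"
    by (intro op.span_minimal OSy_gens_BH \<gamma> subspace_BH)
  then show sub: "OSy \<gamma> \<subseteq> BH"
    unfolding OSy_alt by (rule closure_minimal[OF _ closed_BH])
  show "op.subspace (OSy \<gamma>)"
    unfolding OSy_alt by (rule op_subspace_closure[OF op.subspace_span])
  have "id_blinfun \<in> ?S" by (rule op.span_base) (simp add: OSy_gens_def)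
  then show "id_blinfun \<in> OSy \<gamma>" unfolding OSy_alt using closure_subset by blast
  have "adj x \<in> ?S" if "x \<in> ?S" for x
  proof -
    \<comment> \<open>Membership in \<open>BH\<close> is carried through the induction because
      \<open>adj\<close> is known to be additive only there.\<close>
    have "x \<in> BH \<and> adj x \<in> ?S"
      using that
    proof (induction rule: op.span_induct_alt)
      case base
      have "adj (0 :: 'h op) = 0"
        by (rule adj_unique) (simp_all add: op.subspace_0[OF subspace_BH] cinner.zero_left cinner.zero_right)
      then show ?case by (simp add: op.span_zero op.subspace_0[OF subspace_BH])
    next
      case (step c x y)
      have "x \<in> BH" using step(1) OSy_gens_BH[of \<gamma>] \<gamma> by blast
      moreover have "adj x \<in> ?S" using adj_OSy_gens[OF \<gamma> step(1)] by (rule op.span_base)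
      moreover have "op_scaleC c x \<in> BH" by (rule op.subspace_scale[OF subspace_BH \<open>x \<in> BH\<close>])
      ultimately show ?case
        using step(2)
        by (simp add: adj_add adj_scale op.span_add op.span_scale op.subspace_add[OF subspace_BH])
    qed
    then show ?thesis ..
  qed
  then have "adj ` ?S \<subseteq> OSy \<gamma>" unfolding OSy_alt using closure_subset by blast
  then show "adj ` OSy \<gamma> \<subseteq> OSy \<gamma>"
    using continuous_on_subset[OF continuous_on_adj sub]
    unfolding OSy_alt by (intro image_closure_subset) auto
qed

section \<open>Unital completely positive maps and the defect\<close>

lemma mform_adj:
  assumes "\<And>i j. i < n \<Longrightarrow> j < n \<Longrightarrow> a i j \<in> BH"
  shows "mform n (\<lambda>i j. adj (a j i)) \<xi> = cnj (mform n a \<xi>)"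
proof -
  have "mform n (\<lambda>i j. adj (a j i)) \<xi>
      = (\<Sum>i<n. \<Sum>j<n. cnj (cinner (blinfun_apply (a j i) (\<xi> i)) (\<xi> j)))"
    unfolding mform_alt by (intro sum.cong refl) (simp add: assms cinner_adj_left)
  then show ?thesis
    by (subst (asm) sum.swap) (simp add: mform_alt)
qed

text \<open>The case distinction sits inside the scalar, so every entry is a multiple of
  \<open>id_blinfun\<close> and unital linear maps fix it without a case split.\<close>

definition scalar_mat :: "complex \<Rightarrow> nat \<Rightarrow> nat \<Rightarrow> 'h :: chilbert_space op" where
  "scalar_mat c i j = op_scaleC (if i = j then c else 0) id_blinfun"

lemma mform_scalar_mat: "mform n (scalar_mat c) \<xi> = c * of_real (sqsum n \<xi>)"
proof -
  have "mform n (scalar_mat c) \<xi> = (\<Sum>i<n. \<Sum>j<n. if i = j then c * cinner (\<xi> j) (\<xi> i) else 0)"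
    unfolding mform_alt scalar_mat_def
    by (intro sum.cong refl) (simp add: op_scaleC.rep_eq cinner_scaleC_left)
  then show ?thesis
    by (simp add: sum.delta cinner_self sqsum_def sum_distrib_left)
qed

text \<open>Splitting a matrix over an operator system into its self-adjoint real and imaginary parts
  turns almost positivity into positivity of three matrices over the same system.\<close>

lemma ucp_almost_pos:
  fixes X Y :: "'h :: chilbert_space op set"
  assumes X: "operator_system X" and \<phi>: "ucp X Y \<phi>"
    and a: "\<And>i j. i < n \<Longrightarrow> j < n \<Longrightarrow> a i j \<in> X" and pos: "almost_pos n a e"
  shows "almost_pos n (\<lambda>i j. \<phi> (a i j)) e"
proof -
  have sub: "op.subspace X" and BH: "X \<subseteq> BH" and id: "id_blinfun \<in> X"
    and adj: "\<And>x. x \<in> X \<Longrightarrow> adj x \<in> X"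
    using X by (auto simp: operator_system_def)
  have \<phi>_add: "\<phi> (x + y) = \<phi> x + \<phi> y" if "x \<in> X" "y \<in> X" for x y
    using \<phi> that by (auto simp: ucp_def)
  have \<phi>_scale: "\<phi> (op_scaleC c x) = op_scaleC c (\<phi> x)" if "x \<in> X" for c x
    using \<phi> that by (auto simp: ucp_def)
  have \<phi>_id: "\<phi> id_blinfun = id_blinfun" using \<phi> by (auto simp: ucp_def)
  have \<phi>_pos: "\<forall>n a. (\<forall>i<n. \<forall>j<n. a i j \<in> X) \<longrightarrow> mat_pos n a \<longrightarrow> mat_pos n (\<lambda>i j. \<phi> (a i j))"
    using \<phi> unfolding ucp_def by (elim conjE)
  \<comment> \<open>Cartesian decomposition a = h + i k. The adjoint matrix has entries
    \<open>adj (a j i)\<close>, with transposed indices, so \<open>h\<close> and \<open>k\<close>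
    are self-adjoint as matrices although their entries need not be.\<close>
  define h where "h i j = op_scaleC (1/2) (a i j + adj (a j i))" for i j
  define k where "k i j = op_scaleC (- \<i> / 2) (a i j + op_scaleC (- 1) (adj (a j i)))" for i j
  have hX: "h i j \<in> X" and kX: "k i j \<in> X" if "i < n" "j < n" for i j
    unfolding h_def k_def
    by (intro op.subspace_scale[OF sub] op.subspace_add[OF sub] a adj that)+
  have ahk: "a i j = h i j + op_scaleC \<i> (k i j)" for i j
  proof -
    have "h i j + op_scaleC \<i> (k i j)
      = op_scaleC (1/2) (a i j + adj (a j i)) + op_scaleC (1/2) (a i j + op_scaleC (- 1) (adj (a j i)))"
      by (simp add: h_def k_def)
    also have "\<dots> = op_scaleC (1/2 + 1/2) (a i j)"
      by (simp only: op.scale_right_distrib op.scale_scale op.scale_left_distrib) simp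
    finally show ?thesis by simp
  qed
  have adj_form: "mform n (\<lambda>i j. adj (a j i)) \<xi> = cnj (mform n a \<xi>)" for \<xi>
    by (rule mform_adj) (use a BH in blast)
  have h_form: "mform n h \<xi> = of_real (Re (mform n a \<xi>))" for \<xi>
    unfolding h_def by (simp add: mform_scale mform_add adj_form complex_add_cnj)
  have k_form: "mform n k \<xi> = of_real (Im (mform n a \<xi>))" for \<xi>
    unfolding k_def mform_scale mform_add adj_form by (simp add: complex_eq_iff)
  \<comment> \<open>Unitality enters here: \<open>\<phi>\<close> fixes the scalar matrix
    \<open>e\<close>, so positivity of c b + e passes to c \<phi>(b) + e. It is applied to
    \<open>h\<close> with \<open>c = 1\<close> and to \<open>k\<close> with c = 1 and c =
    -1.\<close>
  have transfer: "mform n (\<lambda>i j. \<phi> (b i j)) \<xi> * c + of_real (e * sqsum n \<xi>) \<in> \<real>\<^sub>\<ge>\<^sub>0"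
    if b: "\<And>i j. i < n \<Longrightarrow> j < n \<Longrightarrow> b i j \<in> X"
      and p: "\<And>\<eta>. mform n b \<eta> * c + of_real (e * sqsum n \<eta>) \<in> \<real>\<^sub>\<ge>\<^sub>0" for b c \<xi>
  proof -
    define m where "m i j = op_scaleC c (b i j) + scalar_mat (of_real e) i j" for i j
    have mX: "m i j \<in> X" if "i < n" "j < n" for i j
      unfolding m_def scalar_mat_def using b[OF that] id
      by (intro op.subspace_add[OF sub] op.subspace_scale[OF sub])
    have "mat_pos n m"
      unfolding mat_pos_def mform_def[symmetric] m_def
      using p by (simp add: mform_add mform_scale mform_scalar_mat mult.commute)
    then have pos_m: "mat_pos n (\<lambda>i j. \<phi> (m i j))"
      using \<phi>_pos[rule_format, of n m] mX by blast
    have m_eq: "\<phi> (m i j) = op_scaleC c (\<phi> (b i j)) + scalar_mat (of_real e) i j"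
      if "i < n" "j < n" for i j
      unfolding m_def scalar_mat_def using b[OF that] id
      by (simp add: \<phi>_add \<phi>_scale \<phi>_id op.subspace_scale[OF sub] del: op.scale_zero_left)
    have "mat_pos n (\<lambda>i j. op_scaleC c (\<phi> (b i j)) + scalar_mat (of_real e) i j)"
      using pos_m by (subst mat_pos_cong[of n _ "\<lambda>i j. \<phi> (m i j)"]) (simp_all add: m_eq)
    then show ?thesis
      unfolding mat_pos_def mform_def[symmetric]
      by (simp add: mform_add mform_scale mform_scalar_mat mult.commute)
  qed
  note P = pos[unfolded almost_pos_def, rule_format]
  have h_pos: "mform n (\<lambda>i j. \<phi> (h i j)) \<xi> * 1 + of_real (e * sqsum n \<xi>) \<in> \<real>\<^sub>\<ge>\<^sub>0" for \<xi>
  proof (rule transfer[OF hX])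
    fix \<eta> show "mform n h \<eta> * 1 + of_real (e * sqsum n \<eta>) \<in> \<real>\<^sub>\<ge>\<^sub>0"
      using P[of \<eta>] by (simp add: h_form complex_nonneg_Reals_iff)
  qed
  have k_pos: "mform n (\<lambda>i j. \<phi> (k i j)) \<xi> * c + of_real (e * sqsum n \<xi>) \<in> \<real>\<^sub>\<ge>\<^sub>0"
    if "c = 1 \<or> c = - 1" for c \<xi>
  proof (rule transfer[OF kX])
    fix \<eta> show "mform n k \<eta> * c + of_real (e * sqsum n \<eta>) \<in> \<real>\<^sub>\<ge>\<^sub>0"
      using P[of \<eta>] that by (auto simp: k_form complex_nonneg_Reals_iff)
  qed
  have "mform n (\<lambda>i j. \<phi> (a i j)) \<xi>
      = mform n (\<lambda>i j. \<phi> (h i j)) \<xi> + \<i> * mform n (\<lambda>i j. \<phi> (k i j)) \<xi>" for \<xi>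
  proof -
    have "mform n (\<lambda>i j. \<phi> (a i j)) \<xi>
      = mform n (\<lambda>i j. \<phi> (h i j) + op_scaleC \<i> (\<phi> (k i j))) \<xi>"
      unfolding ahk using hX kX
      by (intro mform_cong) (simp add: \<phi>_add \<phi>_scale op.subspace_scale[OF sub])
    then show ?thesis by (simp add: mform_add mform_scale)
  qed
  \<comment> \<open>The transferred positivity forces the forms of \<phi>(h) and \<phi>(k) to be
    real; hence they are the real and imaginary parts of the form of \<phi>(a).\<close>
  then have "- Re (mform n (\<lambda>i j. \<phi> (a i j)) \<xi>) \<le> e * sqsum n \<xi> \<and>
      \<bar>Im (mform n (\<lambda>i j. \<phi> (a i j)) \<xi>)\<bar> \<le> e * sqsum n \<xi>" for \<xi>
    using h_pos[of \<xi>] k_pos[of 1 \<xi>] k_pos[of "- 1" \<xi>]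
    by (simp add: complex_nonneg_Reals_iff abs_le_iff)
  then show ?thesis unfolding almost_pos_def by blast
qed

lemma complete_order_iso_pos_defect:
  fixes X Y :: "'h :: chilbert_space op set"
  assumes X: "operator_system X" and Y: "operator_system Y"
    and \<phi>: "bij_betw \<phi> X Y" "ucp X Y \<phi>" "ucp Y X (inv_into X \<phi>)"
    and a: "\<And>i j. i < n \<Longrightarrow> j < n \<Longrightarrow> a i j \<in> X"
  shows "pos_defect n (\<lambda>i j. \<phi> (a i j)) = pos_defect n a"
proof (rule antisym)
  show "pos_defect n (\<lambda>i j. \<phi> (a i j)) \<le> pos_defect n a"
    unfolding pos_defect_le_iff[OF pos_defect_nonneg]
    by (rule ucp_almost_pos[OF X \<phi>(2) a almost_pos_pos_defect])
  have "\<phi> (a i j) \<in> Y" if "i < n" "j < n" for i j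
    using a[OF that] \<phi>(1) by (auto simp: bij_betw_def)
  then have "almost_pos n (\<lambda>i j. inv_into X \<phi> (\<phi> (a i j))) (pos_defect n (\<lambda>i j. \<phi> (a i j)))"
    by (rule ucp_almost_pos[OF Y \<phi>(3) _ almost_pos_pos_defect])
  then show "pos_defect n a \<le> pos_defect n (\<lambda>i j. \<phi> (a i j))"
    unfolding pos_defect_le_iff[OF pos_defect_nonneg]
    using a \<phi>(1) by (subst almost_pos_cong) (auto simp: bij_betw_def inv_into_f_f)
qed

section \<open>Complete order embeddings\<close>

text \<open>Equality of defects is what matching tuples deliver directly. It implies that positivity
  is preserved and reflected at every matrix size, and it makes the map injective.\<close>

definition complete_order_embedding ::
    "'h :: chilbert_space op set \<Rightarrow> 'h op set \<Rightarrow> ('h op \<Rightarrow> 'h op) \<Rightarrow> bool" where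
  "complete_order_embedding X Y \<phi> \<longleftrightarrow>
     op_linear_on X \<phi> \<and> \<phi> ` X \<subseteq> Y \<and> \<phi> id_blinfun = id_blinfun \<and>
     (\<forall>n a. (\<forall>i<n. \<forall>j<n. a i j \<in> X) \<longrightarrow> pos_defect n (\<lambda>i j. \<phi> (a i j)) = pos_defect n a)"

lemma complete_order_embeddingI:
  assumes "op_linear_on X \<phi>" "\<phi> ` X \<subseteq> Y" "\<phi> id_blinfun = id_blinfun"
    and "\<And>n a. (\<And>i j. i < n \<Longrightarrow> j < n \<Longrightarrow> a i j \<in> X) \<Longrightarrow>
      pos_defect n (\<lambda>i j. \<phi> (a i j)) = pos_defect n a"
  shows "complete_order_embedding X Y \<phi>"
  unfolding complete_order_embedding_def
proof (intro conjI allI impI)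
  show "pos_defect n (\<lambda>i j. \<phi> (a i j)) = pos_defect n a" if "\<forall>i<n. \<forall>j<n. a i j \<in> X" for n a
    by (rule assms(4)) (simp add: that)
qed (fact assms(1-3))+

lemma complete_order_embeddingD:
  assumes "complete_order_embedding X Y \<phi>"
  shows "op_linear_on X \<phi>" "\<phi> ` X \<subseteq> Y" "\<phi> id_blinfun = id_blinfun"
    and "(\<And>i j. i < n \<Longrightarrow> j < n \<Longrightarrow> a i j \<in> X) \<Longrightarrow>
      pos_defect n (\<lambda>i j. \<phi> (a i j)) = pos_defect n a"
proof -
  have *: "op_linear_on X \<phi>" "\<phi> ` X \<subseteq> Y" "\<phi> id_blinfun = id_blinfun"
    "\<forall>n a. (\<forall>i<n. \<forall>j<n. a i j \<in> X) \<longrightarrow> pos_defect n (\<lambda>i j. \<phi> (a i j)) = pos_defect n a"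
    using assms unfolding complete_order_embedding_def by - (elim conjE, assumption)+
  show "op_linear_on X \<phi>" "\<phi> ` X \<subseteq> Y" "\<phi> id_blinfun = id_blinfun" by (fact *)+
  show "pos_defect n (\<lambda>i j. \<phi> (a i j)) = pos_defect n a"
    if "\<And>i j. i < n \<Longrightarrow> j < n \<Longrightarrow> a i j \<in> X"
    by (rule *(4)[rule_format]) (rule that)
qed

text \<open>Zero is the only operator that is positive together with its negative. Linear relations
  thus become visible in the defects.\<close>

lemma eq_0_iff_pos_defect:
  fixes T :: "'h :: chilbert_space op"
  assumes "T \<in> BH"
  shows "T = 0 \<longleftrightarrow> pos_defect 1 (\<lambda>i j. T) = 0 \<and> pos_defect 1 (\<lambda>i j. - T) = 0"
proof
  have "mat_pos 1 (\<lambda>i j. 0 :: 'h op)" by (simp add: mat_pos_def cinner.zero_left)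
  then show "T = 0 \<Longrightarrow> pos_defect 1 (\<lambda>i j. T) = 0 \<and> pos_defect 1 (\<lambda>i j. - T) = 0"
    by (simp add: mat_pos_iff_pos_defect)
  show "pos_defect 1 (\<lambda>i j. T) = 0 \<and> pos_defect 1 (\<lambda>i j. - T) = 0 \<Longrightarrow> T = 0"
    using norm_le_pos_defect[OF assms] by simp
qed

lemma op_linear_on_uminus:
  assumes "op_linear_on X \<phi>" "x \<in> X"
  shows "\<phi> (- x) = - \<phi> x"
proof -
  have "\<phi> (op_scaleC (- 1) x) = op_scaleC (- 1) (\<phi> x)"
    using assms unfolding op_linear_on_def by blast
  then show ?thesis by simp
qed

lemma op_linear_on_diff:
  assumes "op_linear_on X \<phi>" "op.subspace X" "x \<in> X" "y \<in> X"
  shows "\<phi> (x - y) = \<phi> x - \<phi> y"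
proof -
  have "\<phi> (x + - y) = \<phi> x + \<phi> (- y)"
    using assms op.subspace_neg[OF assms(2)] unfolding op_linear_on_def by blast
  then show ?thesis using op_linear_on_uminus[OF assms(1,4)] by simp
qed

lemma complete_order_embedding_inj:
  fixes X Y :: "'h :: chilbert_space op set"
  assumes X: "operator_system X" and Y: "operator_system Y"
    and \<phi>: "complete_order_embedding X Y \<phi>"
  shows "inj_on \<phi> X"
proof (rule inj_onI)
  fix u v assume uv: "u \<in> X" "v \<in> X" "\<phi> u = \<phi> v"
  have sub: "op.subspace X" "X \<subseteq> BH" using X by (auto simp: operator_system_def)
  note lin = complete_order_embeddingD(1)[OF \<phi>] and pd = complete_order_embeddingD(4)[OF \<phi>]
  define w where "w = u - v"
  have w: "w \<in> X" "- w \<in> X" unfolding w_def using uv op.subspace_diff[OF sub(1)] by auto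
  have "\<phi> w = 0" "\<phi> (- w) = 0"
    using op_linear_on_diff[OF lin sub(1) uv(1,2)] op_linear_on_uminus[OF lin w(1)] uv(3)
    by (simp_all add: w_def)
  moreover have "pos_defect 1 (\<lambda>i j. \<phi> w) = pos_defect 1 (\<lambda>i j. w)"
    "pos_defect 1 (\<lambda>i j. \<phi> (- w)) = pos_defect 1 (\<lambda>i j. - w)"
    using pd[of 1 "\<lambda>i j. w"] pd[of 1 "\<lambda>i j. - w"] w by auto
  moreover have "pos_defect 1 (\<lambda>i j. 0 :: 'h op) = 0"
    using eq_0_iff_pos_defect[OF op.subspace_0[OF subspace_BH]] by blast
  ultimately have "w = 0" using eq_0_iff_pos_defect[of w] w sub(2) by auto
  then show "u = v" by (simp add: w_def)
qed

lemma ucp_linear: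
  assumes "ucp X Y \<phi>"
  shows "op_linear_on X \<phi>" "\<phi> ` X \<subseteq> Y" "\<phi> id_blinfun = id_blinfun"
proof -
  have "\<phi> \<in> X \<rightarrow> Y" "\<forall>x\<in>X. \<forall>y\<in>X. \<phi> (x + y) = \<phi> x + \<phi> y"
    "\<forall>c. \<forall>x\<in>X. \<phi> (op_scaleC c x) = op_scaleC c (\<phi> x)" "\<phi> id_blinfun = id_blinfun"
    using assms unfolding ucp_def by - (elim conjE, assumption)+
  then show "op_linear_on X \<phi>" "\<phi> ` X \<subseteq> Y" "\<phi> id_blinfun = id_blinfun"
    unfolding op_linear_on_def by blast+
qed

text \<open>Splits a symmetric relation into two one-sided ones. Conversely, \<open>\<psi>\<close>
  enters only through the dimension count that makes \<open>\<phi>\<close> onto; the inverse of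
  \<open>\<phi>\<close> is completely positive because \<open>\<phi>\<close> preserves defects
  exactly.\<close>

lemma complete_order_iso_iff_embeddings:
  fixes X Y :: "'h :: chilbert_space op set"
  assumes X: "operator_system X" "fin_dim op_scaleC X" and Y: "operator_system Y" "fin_dim op_scaleC Y"
  shows "complete_order_iso X Y \<longleftrightarrow>
    (\<exists>\<phi>. complete_order_embedding X Y \<phi>) \<and> (\<exists>\<psi>. complete_order_embedding Y X \<psi>)"
proof (intro iffI conjI)
  assume "complete_order_iso X Y"
  then obtain \<phi> where \<phi>: "bij_betw \<phi> X Y" "ucp X Y \<phi>" "ucp Y X (inv_into X \<phi>)"
    by (auto simp: complete_order_iso_def)
  note pd = complete_order_iso_pos_defect[OF X(1) Y(1) \<phi>]
  show "\<exists>\<phi>. complete_order_embedding X Y \<phi>"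
    using complete_order_embeddingI[OF ucp_linear[OF \<phi>(2)] pd] by blast
  have "pos_defect n (\<lambda>i j. inv_into X \<phi> (b i j)) = pos_defect n b"
    if b: "\<And>i j. i < n \<Longrightarrow> j < n \<Longrightarrow> b i j \<in> Y" for n b
  proof -
    have "inv_into X \<phi> (b i j) \<in> X" "\<phi> (inv_into X \<phi> (b i j)) = b i j" if "i < n" "j < n" for i j
      using b[OF that] \<phi>(1)
      by (auto simp: bij_betw_def inv_into_into f_inv_into_f)
    then show ?thesis
      using pd[of n "\<lambda>i j. inv_into X \<phi> (b i j)"]
        pos_defect_cong[of n "\<lambda>i j. \<phi> (inv_into X \<phi> (b i j))" b] by simp
  qed
  from complete_order_embeddingI[OF ucp_linear[OF \<phi>(3)] this]
  show "\<exists>\<psi>. complete_order_embedding Y X \<psi>" by blast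
next
  assume "(\<exists>\<phi>. complete_order_embedding X Y \<phi>) \<and> (\<exists>\<psi>. complete_order_embedding Y X \<psi>)"
  then obtain \<phi> \<psi> where emb: "complete_order_embedding X Y \<phi>" "complete_order_embedding Y X \<psi>"
    by blast
  have inj: "inj_on \<phi> X" "inj_on \<psi> Y"
    using complete_order_embedding_inj[OF X(1) Y(1) emb(1)]
      complete_order_embedding_inj[OF Y(1) X(1) emb(2)] .
  note lin = complete_order_embeddingD(1)[OF emb(1)] and id = complete_order_embeddingD(3)[OF emb(1)]
    and pd = complete_order_embeddingD(4)[OF emb(1)]
  have im: "\<phi> ` X = Y"
    by (rule fin_dim_mutual_injections[OF X(2) Y(2)
          complete_order_embeddingD(1)[OF emb(1)] inj(1) complete_order_embeddingD(2)[OF emb(1)]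
          complete_order_embeddingD(1)[OF emb(2)] inj(2) complete_order_embeddingD(2)[OF emb(2)]])
  define \<theta> where "\<theta> = inv_into X \<phi>"
  have \<theta>: "\<theta> (\<phi> u) = u" if "u \<in> X" for u using inj(1) that by (simp add: \<theta>_def)
  have \<theta>Y: "\<theta> v \<in> X" "\<phi> (\<theta> v) = v" if "v \<in> Y" for v
    using im that by (auto simp: \<theta>_def inv_into_into f_inv_into_f)
  have subX: "op.subspace X" and idX: "id_blinfun \<in> X"
    using X(1) by (auto simp: operator_system_def)
  have "ucp X Y \<phi>"
    unfolding ucp_def
  proof (intro conjI allI impI)
    show "mat_pos n (\<lambda>i j. \<phi> (a i j))" if "\<forall>i<n. \<forall>j<n. a i j \<in> X" "mat_pos n a" for n a
      using that pd[of n a] by (simp add: mat_pos_iff_pos_defect)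
  qed (use lin id im in \<open>auto simp: op_linear_on_def\<close>)
  moreover have "ucp Y X \<theta>"
    unfolding ucp_def
  proof (intro conjI allI impI ballI)
    show "\<theta> \<in> Y \<rightarrow> X" using \<theta>Y by blast
    show "\<theta> (u + v) = \<theta> u + \<theta> v" if "u \<in> Y" "v \<in> Y" for u v
    proof -
      have "\<phi> (\<theta> u + \<theta> v) = u + v" using lin \<theta>Y that by (simp add: op_linear_on_def)
      then show ?thesis using \<theta>[of "\<theta> u + \<theta> v"] \<theta>Y that op.subspace_add[OF subX] by metis
    qed
    show "\<theta> (op_scaleC c u) = op_scaleC c (\<theta> u)" if "u \<in> Y" for c u
    proof -
      have "\<phi> (op_scaleC c (\<theta> u)) = op_scaleC c u" using lin \<theta>Y that by (simp add: op_linear_on_def)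
      then show ?thesis using \<theta>[of "op_scaleC c (\<theta> u)"] \<theta>Y that op.subspace_scale[OF subX] by metis
    qed
    show "\<theta> id_blinfun = id_blinfun" using \<theta>[OF idX] id by simp
    show "mat_pos n (\<lambda>i j. \<theta> (a i j))" if a: "\<forall>i<n. \<forall>j<n. a i j \<in> Y" "mat_pos n a" for n a
    proof -
      have "pos_defect n (\<lambda>i j. \<theta> (a i j)) = pos_defect n (\<lambda>i j. \<phi> (\<theta> (a i j)))"
        using pd[of n "\<lambda>i j. \<theta> (a i j)"] a(1) \<theta>Y by simp
      also have "\<dots> = pos_defect n a" by (rule pos_defect_cong) (use a(1) \<theta>Y in auto)
      finally show ?thesis using a(2) by (simp add: mat_pos_iff_pos_defect)
    qed
  qed
  ultimately show "complete_order_iso X Y"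
    unfolding complete_order_iso_def \<theta>_def using inj(1) im by (auto simp: bij_betw_def)
qed

section \<open>Types of tuples\<close>

definition comb :: "nat \<Rightarrow> (nat \<Rightarrow> complex) \<Rightarrow> (nat \<Rightarrow> 'h op) \<Rightarrow> 'h :: chilbert_space op" where
  "comb d c x = (\<Sum>k\<le>d. op_scaleC (c k) (x k))"

text \<open>The last entry of a tuple is the unit, so that pencils need no separate constant term.\<close>

definition unital_tuple :: "nat \<Rightarrow> 'h :: chilbert_space op set \<Rightarrow> (nat \<Rightarrow> 'h op) \<Rightarrow> bool" where
  "unital_tuple d X x \<longleftrightarrow> x d = id_blinfun \<and> (\<forall>k<d. x k \<in> X)"

lemma unital_tuple_in:
  "operator_system X \<Longrightarrow> unital_tuple d X x \<Longrightarrow> k \<le> d \<Longrightarrow> x k \<in> X"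
  by (auto simp: unital_tuple_def operator_system_def le_less)

lemma comb_in: "operator_system X \<Longrightarrow> unital_tuple d X x \<Longrightarrow> comb d c x \<in> X"
  unfolding comb_def
  by (intro op.subspace_sum op.subspace_scale) (auto simp: unital_tuple_in operator_system_def)

lemma comb_add: "comb d (\<lambda>k. c k + c' k) x = comb d c x + comb d c' x"
  by (simp add: comb_def op.scale_left_distrib sum.distrib)

lemma comb_scale: "comb d (\<lambda>k. b * c k) x = op_scaleC b (comb d c x)"
  by (simp add: comb_def op.scale_sum_right)

lemma comb_minus: "comb d (\<lambda>k. - c k) x = - comb d c x"
  using comb_scale[of d "- 1" c x] by simp

lemma comb_diff: "comb d (\<lambda>k. c k - c' k) x = comb d c x - comb d c' x"
  using comb_add[of d c "\<lambda>k. - c' k" x] by (simp add: comb_minus)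

lemma comb_unit: "k \<le> d \<Longrightarrow> comb d (\<lambda>i. if i = k then c else 0) x = op_scaleC c (x k)"
proof -
  assume "k \<le> d"
  have "comb d (\<lambda>i. if i = k then c else 0) x = (\<Sum>i\<le>d. if i = k then op_scaleC c (x i) else 0)"
    unfolding comb_def by (intro sum.cong) auto
  then show ?thesis using \<open>k \<le> d\<close> by simp
qed

text \<open>A finite spanning set with the unit appended. The entries may be dependent, so
  coefficients are not unique; the appended unit receives coefficient 0.\<close>

lemma unital_tuple_spanning:
  fixes X :: "'h :: chilbert_space op set"
  assumes "fin_dim op_scaleC X"
  obtains d x where "unital_tuple d X x" "\<And>v. v \<in> X \<Longrightarrow> \<exists>c. v = comb d c x"
proof -
  obtain B where B: "finite B" "op.span B = X" using assms by (auto simp: fin_dim_def)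
  obtain d f where f: "B = f ` {i::nat. i < d}" "inj_on f {i. i < d}"
    using finite_imp_nat_seg_image_inj_on[OF B(1)] by blast
  define x where "x k = (if k < d then f k else id_blinfun)" for k
  show ?thesis
  proof (rule that)
    show "unital_tuple d X x"
      using op.span_superset[of B] B(2) f(1) by (auto simp: unital_tuple_def x_def)
    fix v assume "v \<in> X"
    then obtain u where "v = (\<Sum>b\<in>B. op_scaleC (u b) b)"
      using op.span_finite[OF B(1)] B(2) by auto
    then have "v = (\<Sum>k<d. op_scaleC (u (f k)) (f k))"
      using f by (simp add: sum.reindex lessThan_def)
    also have "\<dots> = comb d (\<lambda>k. if k < d then u (f k) else 0) x"
      by (simp add: comb_def x_def flip: lessThan_Suc_atMost)
    finally show "\<exists>c. v = comb d c x" by blast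
  qed
qed

text \<open>The map sends each combination of \<open>x\<close> to the same combination of
  \<open>y\<close>. It is well defined because a combination vanishes iff the 1 by 1 defects of it
  and its negative do; it is unital because both tuples end in the unit.\<close>

lemma complete_order_embedding_exists:
  fixes X Y :: "'h :: chilbert_space op set"
  assumes X: "operator_system X" and Y: "operator_system Y"
    and x: "unital_tuple d X x" and span: "\<And>v. v \<in> X \<Longrightarrow> \<exists>c. v = comb d c x"
    and y: "unital_tuple d Y y"
    and pd: "\<And>n c. pos_defect n (\<lambda>i j. comb d (c i j) x) = pos_defect n (\<lambda>i j. comb d (c i j) y)"
  shows "\<exists>\<phi>. complete_order_embedding X Y \<phi>"
proof -
  have BH: "comb d c x \<in> BH" "comb d c y \<in> BH" for c
    using comb_in[OF X x] comb_in[OF Y y] X Y by (auto simp: operator_system_def)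
  have zero: "comb d c x = 0 \<longleftrightarrow> comb d c y = 0" for c
    using pd[of 1 "\<lambda>i j. c"] pd[of 1 "\<lambda>i j k. - c k"]
    by (simp add: eq_0_iff_pos_defect[OF BH(1)] eq_0_iff_pos_defect[OF BH(2)] comb_minus)
  have eq: "comb d c y = comb d c' y" if "comb d c x = comb d c' x" for c c'
    using zero[of "\<lambda>k. c k - c' k"] that by (simp add: comb_diff)
  define \<phi> where "\<phi> v = comb d (SOME c. v = comb d c x) y" for v
  have \<phi>: "\<phi> (comb d c x) = comb d c y" for c
    unfolding \<phi>_def by (rule eq) (rule someI[of "\<lambda>c'. comb d c x = comb d c' x", symmetric], rule refl)
  have "op_linear_on X \<phi>"
    unfolding op_linear_on_def
  proof (intro conjI ballI allI)
    fix u v assume "u \<in> X" "v \<in> X"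
    then obtain c c' where "u = comb d c x" "v = comb d c' x" using span by metis
    then show "\<phi> (u + v) = \<phi> u + \<phi> v" by (simp add: \<phi> flip: comb_add)
  next
    fix b u assume "u \<in> X"
    then obtain c where "u = comb d c x" using span by metis
    then show "\<phi> (op_scaleC b u) = op_scaleC b (\<phi> u)" by (simp add: \<phi> flip: comb_scale)
  qed
  moreover have "\<phi> ` X \<subseteq> Y" using span \<phi> comb_in[OF Y y] by fastforce
  moreover have "\<phi> id_blinfun = id_blinfun"
    using \<phi>[of "\<lambda>i. if i = d then 1 else 0"] x y by (simp add: comb_unit unital_tuple_def)
  moreover have "pos_defect n (\<lambda>i j. \<phi> (a i j)) = pos_defect n a"
    if a: "\<And>i j. i < n \<Longrightarrow> j < n \<Longrightarrow> a i j \<in> X" for n a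
  proof -
    have "\<forall>i j. \<exists>c. i < n \<and> j < n \<longrightarrow> a i j = comb d c x" using a span by blast
    then obtain c where c: "\<And>i j. i < n \<Longrightarrow> j < n \<Longrightarrow> a i j = comb d (c i j) x" by metis
    have "pos_defect n (\<lambda>i j. \<phi> (a i j)) = pos_defect n (\<lambda>i j. comb d (c i j) y)"
      by (rule pos_defect_cong) (simp add: c \<phi>)
    also have "\<dots> = pos_defect n (\<lambda>i j. comb d (c i j) x)" by (rule pd[symmetric])
    also have "\<dots> = pos_defect n a" by (rule pos_defect_cong) (simp add: c)
    finally show ?thesis .
  qed
  ultimately have "complete_order_embedding X Y \<phi>" by (rule complete_order_embeddingI)
  then show ?thesis by (rule exI[of _ \<phi>])
qed

section \<open>Gaussian-rational pencils and finite lists of constraints\<close>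

definition gauss_rats :: "complex set" where
  "gauss_rats = {z. Re z \<in> \<rat> \<and> Im z \<in> \<rat>}"

lemma countable_gauss_rats: "countable gauss_rats"
proof -
  have "gauss_rats \<subseteq> (\<lambda>(a, b). Complex a b) ` (\<rat> \<times> \<rat>)"
  proof
    fix z assume "z \<in> gauss_rats"
    then show "z \<in> (\<lambda>(a, b). Complex a b) ` (\<rat> \<times> \<rat>)"
      by (intro image_eqI[of _ _ "(Re z, Im z)"]) (auto simp: gauss_rats_def)
  qed
  then show ?thesis
    by (rule countable_subset) (intro countable_image countable_SIGMA countable_rat)
qed

lemma closure_gauss_rats: "closure gauss_rats = UNIV"
proof -
  have "\<exists>w\<in>gauss_rats. dist w z < e" if "0 < e" for z e
  proof -
    obtain a b where ab: "a \<in> \<rat>" "Re z - e/2 < a" "a < Re z" "b \<in> \<rat>" "Im z - e/2 < b" "b < Im z"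
      using Rats_dense_in_real[of "Re z - e/2" "Re z"] Rats_dense_in_real[of "Im z - e/2" "Im z"]
        \<open>0 < e\<close> by auto
    have "dist (Complex a b) z \<le> \<bar>a - Re z\<bar> + \<bar>b - Im z\<bar>"
      using cmod_le[of "Complex a b - z"] by (simp add: dist_norm)
    also have "\<dots> < e" using ab by linarith
    finally show ?thesis using ab by (intro bexI[of _ "Complex a b"]) (auto simp: gauss_rats_def)
  qed
  then show ?thesis by (auto simp: closure_approachable)
qed

definition pencil_coeffs :: "nat \<Rightarrow> nat \<Rightarrow> (nat \<times> nat \<times> nat \<Rightarrow> complex) set" where
  "pencil_coeffs d n = ({..<n} \<times> {..<n} \<times> {..d}) \<rightarrow>\<^sub>E gauss_rats"

text \<open>The linear pencil of matrices C_k tensored with the entries x_k, where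
  \<open>c (i, j, k)\<close> is the entry of C_k at (i, j).\<close>

definition pencil :: "nat \<Rightarrow> (nat \<times> nat \<times> nat \<Rightarrow> complex) \<Rightarrow> (nat \<Rightarrow> 'h op) \<Rightarrow>
    nat \<Rightarrow> nat \<Rightarrow> 'h :: chilbert_space op" where
  "pencil d c x i j = comb d (\<lambda>k. c (i, j, k)) x"

lemma countable_pencil_coeffs: "countable (pencil_coeffs d n)"
  unfolding pencil_coeffs_def by (intro countable_PiE countable_gauss_rats) auto

text \<open>Negative rationals are allowed as lower bounds, so that a defect equal to 0 also lies in
  suitable open intervals.\<close>

definition bounds :: "nat \<Rightarrow> (nat \<times> (nat \<times> nat \<times> nat \<Rightarrow> complex) \<times> real \<times> real) set" where
  "bounds d = (SIGMA n:UNIV. pencil_coeffs d n \<times> \<rat> \<times> \<rat>)"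

definition satisfies :: "nat \<Rightarrow> (nat \<times> (nat \<times> nat \<times> nat \<Rightarrow> complex) \<times> real \<times> real) list \<Rightarrow>
    (nat \<Rightarrow> 'h :: chilbert_space op) \<Rightarrow> bool" where
  "satisfies d l x \<longleftrightarrow> (\<forall>(n, c, p, q) \<in> set l.
     p < pos_defect n (pencil d c x) \<and> pos_defect n (pencil d c x) < q)"

definition realizes :: "'h :: chilbert_space op set \<Rightarrow> nat \<Rightarrow>
    (nat \<times> (nat \<times> nat \<times> nat \<Rightarrow> complex) \<times> real \<times> real) list \<Rightarrow> bool" where
  "realizes X d l \<longleftrightarrow> (\<exists>x. unital_tuple d X x \<and> satisfies d l x)"

lemma tendsto_pos_defect_comb:
  assumes "\<And>i j k. i < n \<Longrightarrow> j < n \<Longrightarrow> k \<le> d \<Longrightarrow> ((\<lambda>m. c m i j k) \<longlongrightarrow> c' i j k) F"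
    and "\<And>k. k \<le> d \<Longrightarrow> ((\<lambda>m. x m k) \<longlongrightarrow> x' k) F"
  shows "((\<lambda>m. pos_defect n (\<lambda>i j. comb d (c m i j) (x m)))
    \<longlongrightarrow> pos_defect n (\<lambda>i j. comb d (c' i j) x')) F"
  unfolding comb_def
  by (intro tendsto_pos_defect tendsto_sum op_scale.tendsto assms) auto

lemma tendsto_pos_defect_pencil:
  assumes "\<And>k. k \<le> d \<Longrightarrow> ((\<lambda>m. x m k) \<longlongrightarrow> x' k) F"
  shows "((\<lambda>m. pos_defect n (pencil d c (x m))) \<longlongrightarrow> pos_defect n (pencil d c x')) F"
  unfolding pencil_def comb_def
  by (intro tendsto_pos_defect tendsto_sum op_scale.tendsto tendsto_const assms) auto

text \<open>Pencils commute with linear maps, so the image of a tuple has the same defects.\<close>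

lemma realizes_embedding:
  fixes X Y :: "'h :: chilbert_space op set"
  assumes X: "operator_system X" and \<phi>: "complete_order_embedding X Y \<phi>"
    and l: "realizes X d l"
  shows "realizes Y d l"
proof -
  obtain x where x: "unital_tuple d X x" "satisfies d l x" using l by (auto simp: realizes_def)
  note lin = complete_order_embeddingD(1)[OF \<phi>] and im = complete_order_embeddingD(2)[OF \<phi>]
    and id = complete_order_embeddingD(3)[OF \<phi>] and pd = complete_order_embeddingD(4)[OF \<phi>]
  have "pencil d c (\<lambda>k. \<phi> (x k)) = (\<lambda>i j. \<phi> (pencil d c x i j))" for c
    unfolding pencil_def comb_def fun_eq_iff
    using X unital_tuple_in[OF X x(1)]
    by (subst op_linear_on_sum[OF lin]) (auto simp: operator_system_def)
  then have "pos_defect n (pencil d c (\<lambda>k. \<phi> (x k))) = pos_defect n (pencil d c x)" for n c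
    using pd[of n "pencil d c x"] comb_in[OF X x(1)] by (simp add: pencil_def)
  then have "satisfies d l (\<lambda>k. \<phi> (x k))" using x(2) by (simp add: satisfies_def)
  moreover have "unital_tuple d Y (\<lambda>k. \<phi> (x k))"
    using x(1) im id by (auto simp: unital_tuple_def)
  ultimately show ?thesis by (auto simp: realizes_def)
qed

text \<open>Tuples in \<open>Y\<close> approximating the type of \<open>x\<close> on longer and longer lists of pencils are bounded,
  since the norm is controlled by the defects of \<open>\<plusminus>x\<^sub>k\<close>; a cluster point has the type of \<open>x\<close>.\<close>

lemma realizes_imp_same_type:
  fixes X Y :: "'h :: chilbert_space op set"
  assumes Y: "operator_system Y" "fin_dim op_scaleC Y"
    and x: "unital_tuple d X x"
    and real: "\<And>l. l \<in> lists (bounds d) \<Longrightarrow> realizes X d l \<Longrightarrow> realizes Y d l"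
  shows "\<exists>y. unital_tuple d Y y \<and>
    (\<forall>n c. pos_defect n (\<lambda>i j. comb d (c i j) x) = pos_defect n (\<lambda>i j. comb d (c i j) y))"
proof -
  define Ps where "Ps = (SIGMA n:UNIV. pencil_coeffs d n)"
  define P where "P = from_nat_into Ps"
  define D where "D w z = pos_defect (fst w) (pencil d (snd w) z)"
    for w :: "nat \<times> (nat \<times> nat \<times> nat \<Rightarrow> complex)" and z :: "nat \<Rightarrow> 'h op"
  have "countable Ps" unfolding Ps_def by (intro countable_SIGMA countable_pencil_coeffs) auto
  moreover have "pencil_coeffs d n \<noteq> {}" for n
    by (auto simp: pencil_coeffs_def PiE_eq_empty_iff gauss_rats_def intro: exI[of _ 0])
  then have "Ps \<noteq> {}" by (auto simp: Ps_def)
  ultimately have P: "range P = Ps" unfolding P_def by (intro range_from_nat_into)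
  have "\<exists>p q. p \<in> \<rat> \<and> q \<in> \<rat> \<and> D (P j) x - inverse (real (Suc m)) < p \<and> p < D (P j) x
      \<and> D (P j) x < q \<and> q < D (P j) x + inverse (real (Suc m))" for j m
    using Rats_dense_in_real[of "D (P j) x - inverse (real (Suc m))" "D (P j) x"]
      Rats_dense_in_real[of "D (P j) x" "D (P j) x + inverse (real (Suc m))"] by auto
  then obtain p q where pq: "\<And>j m. p j m \<in> \<rat>" "\<And>j m. q j m \<in> \<rat>"
    "\<And>j m. D (P j) x - inverse (real (Suc m)) < p j m" "\<And>j m. p j m < D (P j) x"
    "\<And>j m. D (P j) x < q j m" "\<And>j m. q j m < D (P j) x + inverse (real (Suc m))"
    by metis
  \<comment> \<open>The m-th list confines the first \<open>m\<close> pencils of the enumeration to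
    within 1 / (m + 1) of their defects at \<open>x\<close>; each fixed pencil is constrained from
    some point on.\<close>
  define l where "l m = map (\<lambda>j. (fst (P j), snd (P j), p j m, q j m)) [0..<m]" for m
  have "snd (P j) \<in> pencil_coeffs d (fst (P j))" for j
    using P by (metis Ps_def mem_Sigma_iff prod.collapse rangeI)
  then have "l m \<in> lists (bounds d)" for m
    using pq(1,2) by (auto simp: l_def bounds_def)
  moreover have "realizes X d (l m)" for m
    unfolding realizes_def
    using x pq(4,5) by (intro exI[of _ x]) (auto simp: satisfies_def l_def D_def)
  ultimately have "\<forall>m. \<exists>y. unital_tuple d Y y \<and> satisfies d (l m) y"
    using real unfolding realizes_def by blast
  then obtain y where y: "\<And>m. unital_tuple d Y (y m)" "\<And>m. satisfies d (l m) (y m)" by metis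
  have near: "norm (D (P j) (y m) - D (P j) x) \<le> inverse (real (Suc m))" if "j < m" for j m
  proof -
    have "p j m < D (P j) (y m) \<and> D (P j) (y m) < q j m"
      using y(2)[of m] that by (auto simp: satisfies_def l_def D_def)
    then show ?thesis using pq(3,6)[of j m] by (simp only: real_norm_def) argo
  qed
  have conv: "(\<lambda>m. D w (y m)) \<longlonglongrightarrow> D w x" if w: "w \<in> Ps" for w
  proof -
    obtain j where j: "w = P j" using w unfolding P[symmetric] by blast
    show ?thesis
      unfolding j
      by (rule LIM_zero_cancel, rule Lim_null_comparison[OF _ LIMSEQ_inverse_real_of_nat],
          rule eventually_mono[OF eventually_gt_at_top[of j] near])
  qed
  have "bounded (range (\<lambda>m. y m k))" if "k < d" for k
  proof -
    \<comment> \<open>The 1 by 1 pencil whose value is \<open>s\<close> times the k-th entry; s = 1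
      and s = -1 supply the two defects that bound its norm.\<close>
    define w where "w s = (1 :: nat, restrict (\<lambda>(i :: nat, j :: nat, k'). if k' = k then s else 0)
        ({..<1} \<times> {..<1} \<times> {..d}))" for s :: complex
    have "w 1 \<in> Ps" "w (- 1) \<in> Ps"
      by (auto simp: w_def Ps_def pencil_coeffs_def gauss_rats_def)
    from this[THEN conv] have "bounded (range (\<lambda>m. D (w 1) (y m)))"
      "bounded (range (\<lambda>m. D (w (- 1)) (y m)))" by (auto intro: convergent_imp_bounded)
    then obtain M M' where M: "\<And>m. D (w 1) (y m) \<le> M" "\<And>m. D (w (- 1)) (y m) \<le> M'"
      unfolding bounded_iff by (metis abs_le_D1 range_eqI real_norm_def)
    have "D (w s) z = pos_defect 1 (\<lambda>i j. op_scaleC s (z k))" for s z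
    proof -
      have "pencil d (snd (w s)) z 0 0 = comb d (\<lambda>k'. if k' = k then s else 0) z"
        unfolding pencil_def comb_def w_def by (intro sum.cong) auto
      then have "pencil d (snd (w s)) z 0 0 = op_scaleC s (z k)"
        using \<open>k < d\<close> by (simp only: comb_unit less_imp_le)
      then have "pos_defect 1 (pencil d (snd (w s)) z) = pos_defect 1 (\<lambda>i j. op_scaleC s (z k))"
        by (intro pos_defect_cong) simp
      then show ?thesis by (simp only: D_def) (simp add: w_def)
    qed
    note Dw = this
    have "norm (y m k) \<le> 4 * (M + M')" for m
    proof -
      have "y m k \<in> BH"
        using y(1)[of m] that Y(1) by (auto simp: unital_tuple_def operator_system_def)
      from norm_le_pos_defect[OF this] show ?thesis
        using M[of m] by (simp add: Dw)
    qed
    then show ?thesis by (auto simp: bounded_iff)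
  qed
  then obtain r t where r: "strict_mono (r :: nat \<Rightarrow> nat)"
    "\<And>k. k < d \<Longrightarrow> t k \<in> Y \<and> (\<lambda>m. y (r m) k) \<longlonglongrightarrow> t k"
    using fin_dim_bounded_tuple_seq[OF Y(2), of d y] y(1) unfolding unital_tuple_def by blast
  \<comment> \<open>The compactness lemma controls only indices below \<open>d\<close>; the unit is
    put back at index \<open>d\<close>.\<close>
  define z where "z k = (if k < d then t k else id_blinfun)" for k
  have z: "unital_tuple d Y z" using r(2) by (simp add: z_def unital_tuple_def)
  have zlim: "(\<lambda>m. y (r m) k) \<longlonglongrightarrow> z k" if "k \<le> d" for k
    using r(2) y(1) that by (cases "k = d") (auto simp: z_def unital_tuple_def)
  have rat: "D w x = D w z" if "w \<in> Ps" for w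
  proof (rule LIMSEQ_unique)
    show "(\<lambda>m. D w (y (r m))) \<longlonglongrightarrow> D w x"
      using LIMSEQ_subseq_LIMSEQ[OF conv[OF that] r(1)] by (simp add: o_def)
    show "(\<lambda>m. D w (y (r m))) \<longlonglongrightarrow> D w z"
      unfolding D_def by (intro tendsto_pos_defect_pencil zlim)
  qed
  have "pos_defect n (\<lambda>i j. comb d (c i j) x) = pos_defect n (\<lambda>i j. comb d (c i j) z)" for n c
  proof -
    \<comment> \<open>Equality on Gaussian-rational pencils extends to all coefficients, since the
      defect is continuous in the coefficients as well.\<close>
    have "\<forall>i j k. \<exists>s. (\<forall>m. s m \<in> gauss_rats) \<and> s \<longlonglongrightarrow> c i j k"
      using closure_gauss_rats closure_sequential[of _ gauss_rats] by auto
    then obtain s where s: "\<And>i j k m. s i j k m \<in> gauss_rats" "\<And>i j k. s i j k \<longlonglongrightarrow> c i j k"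
      by metis
    define e where "e m = restrict (\<lambda>(i, j, k). s i j k m) ({..<n} \<times> {..<n} \<times> {..d})" for m
    have e: "(n, e m) \<in> Ps" for m
      using s(1) by (auto simp: e_def Ps_def pencil_coeffs_def)
    have lim: "(\<lambda>m. pos_defect n (\<lambda>i j. comb d (\<lambda>k. e m (i, j, k)) v))
      \<longlonglongrightarrow> pos_defect n (\<lambda>i j. comb d (c i j) v)" for v :: "nat \<Rightarrow> 'h op"
      by (rule tendsto_pos_defect_comb) (use s(2) in \<open>auto simp: e_def\<close>)
    show ?thesis
    proof (rule LIMSEQ_unique[OF lim])
      show "(\<lambda>m. pos_defect n (\<lambda>i j. comb d (\<lambda>k. e m (i, j, k)) x))
        \<longlonglongrightarrow> pos_defect n (\<lambda>i j. comb d (c i j) z)"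
        using lim[of z] rat[OF e] unfolding D_def pencil_def[abs_def] by simp
    qed
  qed
  then show ?thesis using z by blast
qed

text \<open>All lengths \<open>d\<close> are included because the length of a spanning tuple of
  \<open>X\<close> is not fixed in advance.\<close>

lemma embedding_iff_realizes:
  fixes X Y :: "'h :: chilbert_space op set"
  assumes X: "operator_system X" "fin_dim op_scaleC X" and Y: "operator_system Y" "fin_dim op_scaleC Y"
  shows "(\<exists>\<phi>. complete_order_embedding X Y \<phi>) \<longleftrightarrow>
    (\<forall>d. \<forall>l\<in>lists (bounds d). realizes X d l \<longrightarrow> realizes Y d l)"
proof
  assume *: "\<forall>d. \<forall>l\<in>lists (bounds d). realizes X d l \<longrightarrow> realizes Y d l"
  obtain d x where x: "unital_tuple d X x" "\<And>v. v \<in> X \<Longrightarrow> \<exists>c. v = comb d c x"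
    using unital_tuple_spanning[OF X(2)] by blast
  obtain y where "unital_tuple d Y y"
    "\<And>n c. pos_defect n (\<lambda>i j. comb d (c i j) x) = pos_defect n (\<lambda>i j. comb d (c i j) y)"
    using realizes_imp_same_type[OF Y x(1)] * by blast
  then show "\<exists>\<phi>. complete_order_embedding X Y \<phi>"
    using complete_order_embedding_exists[OF X(1) Y(1) x] by blast
qed (use realizes_embedding[OF X(1)] in blast)

section \<open>Measurability\<close>

lemma space_BH_borel: "space BH_borel = BH"
  unfolding BH_borel_def by (rule space_measure_of) auto

text \<open>The coefficients are weak-operator continuous, and the balls carry the relative
  topology. Measurability of all later functions is derived from these coefficients.\<close>

lemma measurable_cinner_BH_borel:
  fixes x y :: "'h :: chilbert_space"
  shows "(\<lambda>T. cinner (blinfun_apply T x) y) \<in> borel_measurable BH_borel"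
proof (rule borel_measurableI)
  fix U :: "complex set" assume U: "open U"
  let ?V = "{T \<in> BH. cinner (blinfun_apply T x) y \<in> U}"
  have V: "openin wot ?V"
    unfolding wot_def using U
    by (intro topology_generated_by_Basis) blast
  have "?V \<inter> BH_ball n \<in> borel_sets_of (subtopology wot (BH_ball n))" for n
    unfolding borel_sets_of_def
    by (rule sigma_sets.Basic) (use V in \<open>auto simp: openin_subtopology\<close>)
  then have "?V \<in> sets BH_borel" unfolding sets_BH_borel by blast
  moreover have "(\<lambda>T. cinner (blinfun_apply T x) y) -` U \<inter> space BH_borel = ?V"
    by (auto simp: space_BH_borel)
  ultimately show "(\<lambda>T. cinner (blinfun_apply T x) y) -` U \<inter> space BH_borel \<in> sets BH_borel"
    by simp
qed

lemma space_Gamma: "\<gamma> \<in> space Gamma \<longleftrightarrow> (\<forall>n. \<gamma> n \<in> BH)"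
  by (auto simp: Gamma_def space_PiM space_BH_borel)

lemma measurable_cinner_Gamma:
  fixes x y :: "'h :: chilbert_space"
  shows "(\<lambda>\<gamma>. cinner (blinfun_apply (\<gamma> n) x) y) \<in> borel_measurable Gamma"
  unfolding Gamma_def
  by (rule measurable_compose[where f = "\<lambda>\<gamma>. \<gamma> n" and N = BH_borel
        and g = "\<lambda>T. cinner (blinfun_apply T x) y"])
    (simp_all add: measurable_cinner_BH_borel measurable_component_singleton)

section \<open>Countable dense families in the generated operator systems\<close>

text \<open>One countable index type for the unit, the terms of the sequence and their adjoints,
  independent of the sequence; the flag beside \<open>None\<close> is a harmless
  duplication.\<close>

fun generator :: "(nat \<Rightarrow> 'h op) \<Rightarrow> nat option \<times> bool \<Rightarrow> 'h :: chilbert_space op" where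
  "generator \<gamma> (None, b) = id_blinfun"
| "generator \<gamma> (Some n, b) = (if b then adj (\<gamma> n) else \<gamma> n)"

lemma range_generator: "range (generator \<gamma>) = OSy_gens \<gamma>"
proof
  show "range (generator \<gamma>) \<subseteq> OSy_gens \<gamma>"
  proof
    fix g assume "g \<in> range (generator \<gamma>)"
    then obtain w where "g = generator \<gamma> w" by blast
    then show "g \<in> OSy_gens \<gamma>"
      by (cases "(\<gamma>, w)" rule: generator.cases) (auto simp: OSy_gens_def)
  qed
  show "OSy_gens \<gamma> \<subseteq> range (generator \<gamma>)"
    unfolding OSy_gens_def
    by (auto intro: range_eqI[of _ _ "(None, True)"] range_eqI[of _ _ "(Some _, False)"]
        range_eqI[of _ _ "(Some _, True)"])
qed

fun lincomb :: "(complex \<times> nat option \<times> bool) list \<Rightarrow> (nat \<Rightarrow> 'h op) \<Rightarrow> 'h :: chilbert_space op"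
  where
  "lincomb [] \<gamma> = 0"
| "lincomb ((c, w) # l) \<gamma> = op_scaleC c (generator \<gamma> w) + lincomb l \<gamma>"

definition gauss_lists :: "(complex \<times> nat option \<times> bool) list set" where
  "gauss_lists = lists (gauss_rats \<times> UNIV)"

lemma countable_gauss_lists: "countable gauss_lists"
  unfolding gauss_lists_def
  by (intro countable_lists countable_SIGMA countable_gauss_rats) auto

lemma measurable_cinner_generator:
  fixes x y :: "'h :: chilbert_space"
  shows "(\<lambda>\<gamma>. cinner (blinfun_apply (generator \<gamma> w) x) y) \<in> borel_measurable Gamma"
proof (cases w)
  case (Pair n b)
  \<comment> \<open>A coefficient of an adjoint is the conjugate of a coefficient of the operator.
    This holds on \<open>BH\<close> only, hence the comparison on the space of
    \<open>Gamma\<close>.\<close>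
  have adj: "(\<lambda>\<gamma>. cinner (blinfun_apply (adj (\<gamma> n)) x) y) \<in> borel_measurable Gamma" for n
  proof -
    have "cnj \<in> borel_measurable borel"
      using continuous_on_cnj[OF continuous_on_id] by (rule borel_measurable_continuous_onI)
    then have "(\<lambda>\<gamma> :: nat \<Rightarrow> 'h op. cnj (cinner (blinfun_apply (\<gamma> n) y) x)) \<in> borel_measurable Gamma"
      by (rule measurable_compose[OF measurable_cinner_Gamma])
    then show ?thesis
      by (subst measurable_cong[where g = "\<lambda>\<gamma>. cnj (cinner (blinfun_apply (\<gamma> n) y) x)"])
        (auto simp: space_Gamma cinner_adj_left)
  qed
  show ?thesis
    unfolding Pair using adj by (cases n; cases b) (simp_all add: measurable_cinner_Gamma)
qed

lemma measurable_cinner_lincomb: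
  fixes x y :: "'h :: chilbert_space"
  shows "(\<lambda>\<gamma>. cinner (blinfun_apply (lincomb l \<gamma>) x) y) \<in> borel_measurable Gamma"
proof (induction l)
  case (Cons a l)
  then show ?case
    by (cases a) (auto simp: blinfun.add_left cinner_add_left op_scaleC.rep_eq cinner_scaleC_left
        intro!: borel_measurable_add borel_measurable_times measurable_cinner_generator)
qed (simp add: cinner.zero_left)

text \<open>Only scalars need approximating. The countable index set \<open>gauss_lists\<close> is
  the same for all sequences, so quantifying over it gives countable unions of sets of
  sequences.\<close>

lemma closure_lincomb:
  fixes \<gamma> :: "nat \<Rightarrow> 'h :: chilbert_space op"
  shows "closure ((\<lambda>l. lincomb l \<gamma>) ` gauss_lists) = OSy \<gamma>"
proof (rule antisym)
  let ?Z = "(\<lambda>l. lincomb l \<gamma>) ` gauss_lists"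
  have "lincomb l \<gamma> \<in> op.span (OSy_gens \<gamma>)" for l
  proof (induction l)
    case (Cons a l)
    have "generator \<gamma> w \<in> OSy_gens \<gamma>" for w using range_generator[of \<gamma>] by blast
    then show ?case using Cons
      by (cases a) (simp add: op.span_add op.span_scale op.span_base)
  qed (simp add: op.span_zero)
  then show "closure ?Z \<subseteq> OSy \<gamma>" unfolding OSy_alt by (intro closure_mono) auto
  have "x \<in> closure ?Z" if "x \<in> op.span (OSy_gens \<gamma>)" for x
    using that
  proof (induction rule: op.span_induct_alt)
    case base
    have "lincomb [] \<gamma> \<in> ?Z" by (rule imageI) (simp add: gauss_lists_def)
    then show ?case using closure_subset[of ?Z] by (simp only: lincomb.simps subset_eq)
  next
    case (step c g x)
    obtain w where w: "g = generator \<gamma> w" using step(1) range_generator[of \<gamma>] by blast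
    obtain z where z: "\<And>m. z m \<in> ?Z" "z \<longlonglongrightarrow> x" using step(2) unfolding closure_sequential by blast
    obtain q where q: "\<And>m. q m \<in> gauss_rats" "q \<longlonglongrightarrow> c"
      using closure_gauss_rats closure_sequential[of c gauss_rats] by auto
    have "op_scaleC (q m) g + z m \<in> ?Z" for m
    proof -
      obtain l where l: "l \<in> gauss_lists" "z m = lincomb l \<gamma>" using z(1)[of m] by blast
      then have "(q m, w) # l \<in> gauss_lists" using q(1) by (simp add: gauss_lists_def)
      then show ?thesis
        using l(2) by (intro image_eqI[of _ _ "(q m, w) # l"]) (simp_all add: w)
    qed
    moreover have "(\<lambda>m. op_scaleC (q m) g + z m) \<longlonglongrightarrow> op_scaleC c g + x"
      by (intro tendsto_add op_scale.tendsto q z tendsto_const)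
    ultimately show ?case
      unfolding closure_sequential by (intro exI[of _ "\<lambda>m. op_scaleC (q m) g + z m"]) simp
  qed
  then show "OSy \<gamma> \<subseteq> closure ?Z" unfolding OSy_alt by (intro closure_minimal) auto
qed

text \<open>For \<open>e \<ge> 0\<close>, attainment of the infimum and density of \<open>D\<close>
  make the sublevel set a countable intersection of conditions on measurable quadratic
  forms.\<close>

lemma borel_measurable_pos_defect:
  fixes a :: "'b \<Rightarrow> nat \<Rightarrow> nat \<Rightarrow> 'h :: chilbert_space op" and D :: "'h set"
  assumes D: "countable D" "closure D = UNIV"
    and a: "\<And>i j x y. i < n \<Longrightarrow> j < n \<Longrightarrow>
      (\<lambda>w. cinner (blinfun_apply (a w i j) x) y) \<in> borel_measurable M"
  shows "(\<lambda>w. pos_defect n (a w)) \<in> borel_measurable M"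
  unfolding borel_measurable_iff_le
proof
  fix e :: real
  have m: "(\<lambda>w. mform n (a w) \<xi>) \<in> borel_measurable M" for \<xi>
    unfolding mform_alt using a by (intro borel_measurable_sum) auto
  show "{w \<in> space M. pos_defect n (a w) \<le> e} \<in> sets M"
  proof (cases "0 \<le> e")
    case True
    have c: "countable ({..<n} \<rightarrow>\<^sub>E D)" by (intro countable_PiE D) auto
    have "{w \<in> space M. pos_defect n (a w) \<le> e} = {w \<in> space M. \<forall>\<xi> \<in> {..<n} \<rightarrow>\<^sub>E D.
      - Re (mform n (a w) \<xi>) \<le> e * sqsum n \<xi> \<and> \<bar>Im (mform n (a w) \<xi>)\<bar> \<le> e * sqsum n \<xi>}"
      by (simp add: pos_defect_le_iff[OF True] almost_pos_dense[OF D(2)])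
    also have "\<dots> \<in> sets M"
      by (intro sets.sets_Collect_countable_All'[OF _ c] sets.sets_Collect_conj
          borel_measurable_le borel_measurable_uminus borel_measurable_const
          borel_measurable_abs measurable_compose[OF m borel_measurable_Re]
          measurable_compose[OF m borel_measurable_Im])
    finally show ?thesis .
  next
    case False
    then have "{w \<in> space M. pos_defect n (a w) \<le> e} = {}"
      using pos_defect_nonneg by (auto simp: not_le intro: less_le_trans)
    then show ?thesis by (simp only: sets.empty_sets)
  qed
qed

definition lincomb_tuple :: "nat \<Rightarrow> (nat \<Rightarrow> (complex \<times> nat option \<times> bool) list) \<Rightarrow>
    (nat \<Rightarrow> 'h op) \<Rightarrow> nat \<Rightarrow> 'h :: chilbert_space op" where
  "lincomb_tuple d L \<gamma> k = (if k < d then lincomb (L k) \<gamma> else id_blinfun)"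

text \<open>Finitely many strict inequalities between continuous functions survive a small
  perturbation, so a realizing tuple can be replaced entrywise by Gaussian-rational combinations;
  the unit at index \<open>d\<close> stays exact.\<close>

lemma realizes_OSy_iff:
  fixes \<gamma> :: "nat \<Rightarrow> 'h :: chilbert_space op"
  shows "realizes (OSy \<gamma>) d l \<longleftrightarrow>
    (\<exists>L \<in> {..<d} \<rightarrow>\<^sub>E gauss_lists. satisfies d l (lincomb_tuple d L \<gamma>))"
proof
  assume "\<exists>L \<in> {..<d} \<rightarrow>\<^sub>E gauss_lists. satisfies d l (lincomb_tuple d L \<gamma>)"
  then obtain L where L: "L \<in> {..<d} \<rightarrow>\<^sub>E gauss_lists" "satisfies d l (lincomb_tuple d L \<gamma>)" by blast
  have "lincomb (L k) \<gamma> \<in> OSy \<gamma>" if "k < d" for k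
    using L(1) that closure_subset unfolding closure_lincomb[of \<gamma>, symmetric] by fastforce
  then have "unital_tuple d (OSy \<gamma>) (lincomb_tuple d L \<gamma>)"
    by (simp add: unital_tuple_def lincomb_tuple_def)
  then show "realizes (OSy \<gamma>) d l" using L(2) by (auto simp: realizes_def)
next
  assume "realizes (OSy \<gamma>) d l"
  then obtain x where x: "unital_tuple d (OSy \<gamma>) x" "satisfies d l x" by (auto simp: realizes_def)
  have "\<forall>k. \<exists>s. k < d \<longrightarrow> (\<forall>m. s m \<in> gauss_lists) \<and> (\<lambda>m. lincomb (s m) \<gamma>) \<longlonglongrightarrow> x k"
  proof
    fix k
    show "\<exists>s. k < d \<longrightarrow> (\<forall>m. s m \<in> gauss_lists) \<and> (\<lambda>m. lincomb (s m) \<gamma>) \<longlonglongrightarrow> x k"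
    proof (cases "k < d")
      case True
      then have "x k \<in> closure ((\<lambda>l. lincomb l \<gamma>) ` gauss_lists)"
        using x(1) by (simp add: closure_lincomb unital_tuple_def)
      then obtain z where z: "\<And>m. z m \<in> (\<lambda>l. lincomb l \<gamma>) ` gauss_lists" "z \<longlonglongrightarrow> x k"
        unfolding closure_sequential by blast
      then have "\<forall>m. \<exists>l. l \<in> gauss_lists \<and> z m = lincomb l \<gamma>" by blast
      then obtain s where s: "\<And>m. s m \<in> gauss_lists" "\<And>m. z m = lincomb (s m) \<gamma>" by metis
      then have "z = (\<lambda>m. lincomb (s m) \<gamma>)" by blast
      then show ?thesis using z(2) s(1) by blast
    qed simp
  qed
  then obtain s where s: "\<And>k m. k < d \<Longrightarrow> s k m \<in> gauss_lists"
    "\<And>k. k < d \<Longrightarrow> (\<lambda>m. lincomb (s k m) \<gamma>) \<longlonglongrightarrow> x k" by metis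
  define L where "L m = restrict (\<lambda>k. s k m) {..<d}" for m
  have L: "L m \<in> {..<d} \<rightarrow>\<^sub>E gauss_lists" for m using s(1) by (auto simp: L_def)
  have lim: "(\<lambda>m. lincomb_tuple d (L m) \<gamma> k) \<longlonglongrightarrow> x k" if "k \<le> d" for k
    using s(2) x(1) that by (cases "k = d") (auto simp: L_def lincomb_tuple_def unital_tuple_def)
  have "\<forall>\<^sub>F m in sequentially. satisfies d l (lincomb_tuple d (L m) \<gamma>)"
    unfolding satisfies_def
  proof (intro eventually_ball_finite finite_set ballI)
    fix b assume "b \<in> set l"
    moreover obtain n c p q where b: "b = (n, c, p, q)" by (cases b)
    ultimately have "p < pos_defect n (pencil d c x)" "pos_defect n (pencil d c x) < q"
      using x(2) by (auto simp: satisfies_def)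
    then show "\<forall>\<^sub>F m in sequentially. case b of (n, c, p, q) \<Rightarrow>
      p < pos_defect n (pencil d c (lincomb_tuple d (L m) \<gamma>)) \<and>
      pos_defect n (pencil d c (lincomb_tuple d (L m) \<gamma>)) < q"
      using order_tendstoD[OF tendsto_pos_defect_pencil[OF lim]]
      by (simp add: b eventually_conj)
  qed
  then obtain m where "satisfies d l (lincomb_tuple d (L m) \<gamma>)"
    using eventually_happens sequentially_bot by blast
  then show "\<exists>L \<in> {..<d} \<rightarrow>\<^sub>E gauss_lists. satisfies d l (lincomb_tuple d L \<gamma>)" using L by blast
qed

lemma sets_realizes:
  fixes D :: "'h :: chilbert_space set"
  assumes D: "countable D" "closure D = UNIV"
  shows "{\<gamma> \<in> space (Gamma :: (nat \<Rightarrow> 'h op) measure). realizes (OSy \<gamma>) d l} \<in> sets Gamma"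
proof -
  have tup: "(\<lambda>\<gamma>. cinner (blinfun_apply (lincomb_tuple d L \<gamma> k) x) y) \<in> borel_measurable Gamma"
    for L k and x y :: 'h
    by (cases "k < d") (simp_all add: lincomb_tuple_def measurable_cinner_lincomb)
  have "(\<lambda>\<gamma>. cinner (blinfun_apply (pencil d c (lincomb_tuple d L \<gamma>) i j) x) y)
      \<in> borel_measurable Gamma" for c L i j and x y :: 'h
    unfolding pencil_def comb_def
    by (auto simp: blinfun.sum_left cinner.sum_left op_scaleC.rep_eq cinner_scaleC_left
        intro!: borel_measurable_sum borel_measurable_times tup)
  then have pd: "(\<lambda>\<gamma>. pos_defect n (pencil d c (lincomb_tuple d L \<gamma>))) \<in> borel_measurable
      (Gamma :: (nat \<Rightarrow> 'h op) measure)" for n c L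
    by (intro borel_measurable_pos_defect[OF D])
  have sat: "{\<gamma> \<in> space (Gamma :: (nat \<Rightarrow> 'h op) measure). satisfies d l (lincomb_tuple d L \<gamma>)}
      \<in> sets Gamma" for L
    unfolding satisfies_def
  proof (intro sets.sets_Collect_countable_All')
    fix b assume "b \<in> set l"
    obtain n c p q where b: "b = (n, c, p, q)" by (cases b)
    show "{\<gamma> \<in> space (Gamma :: (nat \<Rightarrow> 'h op) measure). case b of (n, c, p, q) \<Rightarrow>
      p < pos_defect n (pencil d c (lincomb_tuple d L \<gamma>)) \<and>
      pos_defect n (pencil d c (lincomb_tuple d L \<gamma>)) < q} \<in> sets Gamma"
      unfolding b prod.case
      by (intro sets.sets_Collect_conj borel_measurable_less borel_measurable_const pd)
  qed (simp add: countable_finite)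
  show ?thesis
    unfolding realizes_OSy_iff
    by (rule sets.sets_Collect_countable_Ex'[OF sat])
      (intro countable_PiE countable_gauss_lists; simp)
qed

section \<open>Coding countably many Borel invariants by one real number\<close>

text \<open>Base 3 with digits 0 and 1 (the range is a dilated Cantor set) avoids the double
  expansions of base 2.\<close>

definition ternary :: "(nat \<Rightarrow> bool) \<Rightarrow> real" where
  "ternary b = (\<Sum>n. (if b n then 1 else 0) * (1/3) ^ n)"

lemma summable_ternary: "summable (\<lambda>n. (if b n then 1 else 0) * (1/3 :: real) ^ n)"
  by (rule summable_comparison_test'[OF summable_geometric[of "1/3 :: real"], of 0]) auto

text \<open>The first differing digit contributes (1/3)^n, while all later digits together
  contribute at most half of that.\<close>

lemma ternary_less:
  assumes "\<And>k. k < n \<Longrightarrow> a k = b k" "a n" "\<not> b n"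
  shows "ternary b < ternary a"
proof -
  define g where "g b k = (if b k then 1 else 0) * (1/3 :: real) ^ k" for b and k :: nat
  have split: "ternary b = (\<Sum>k. g b (k + Suc n)) + g b n + (\<Sum>k<n. g b k)" for b
    using suminf_split_initial_segment[OF summable_ternary[of b], of "Suc n"]
    unfolding ternary_def g_def by simp
  have summ: "summable (\<lambda>k. g b (k + Suc n))" for b
    using summable_ternary[of b] unfolding g_def by (rule summable_ignore_initial_segment)
  have "(\<lambda>k. (1/3 :: real) ^ Suc n * (1/3) ^ k) sums ((1/3) ^ Suc n * (1 / (1 - 1/3)))"
    by (intro sums_mult geometric_sums) simp
  then have geo: "(\<lambda>k. (1/3 :: real) ^ (k + Suc n)) sums ((1/3) ^ n / 2)"
    by (simp add: power_add mult_ac)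
  have "(\<Sum>k. g b (k + Suc n)) \<le> (1/3) ^ n / 2"
    unfolding sums_unique[OF geo]
    by (rule suminf_le[OF _ summ sums_summable[OF geo]]) (simp add: g_def)
  moreover have "0 \<le> (\<Sum>k. g a (k + Suc n))"
    by (rule suminf_nonneg[OF summ]) (simp add: g_def)
  moreover have "g b n = 0" "g a n = (1/3) ^ n" using assms(2,3) by (simp_all add: g_def)
  moreover have "(\<Sum>k<n. g a k) = (\<Sum>k<n. g b k)"
    by (rule sum.cong) (simp_all add: g_def assms(1))
  moreover have "0 < (1/3 :: real) ^ n" by simp
  ultimately show ?thesis unfolding split by argo
qed

lemma inj_ternary: "inj ternary"
proof (rule injI, rule ccontr)
  fix a b assume eq: "ternary a = ternary b" and "a \<noteq> b"
  then have "\<exists>n. a n \<noteq> b n" by auto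
  then obtain n where n: "a n \<noteq> b n" "\<And>k. k < n \<Longrightarrow> a k = b k"
    using exists_least_iff[of "\<lambda>n. a n \<noteq> b n"] by auto
  then show False
    using ternary_less[of n a b] ternary_less[of n b a] eq by (cases "a n") auto
qed

lemma smooth_relation_countable_invariants:
  fixes E :: "'x \<Rightarrow> 'x \<Rightarrow> bool"
  assumes I: "countable I" and P: "\<And>i. i \<in> I \<Longrightarrow> {x \<in> space M. P i x} \<in> sets M"
    and E: "\<And>x y. x \<in> space M \<Longrightarrow> y \<in> space M \<Longrightarrow> E x y \<longleftrightarrow> (\<forall>i\<in>I. P i x \<longleftrightarrow> P i y)"
  shows "smooth_relation M E"
\<comment> \<open>An enumeration of \<open>I\<close> needs it to be nonempty; without invariants all
  points are equivalent and a constant map reduces the relation.\<close>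
proof (cases "I = {}")
  case True
  then show ?thesis
    using E unfolding smooth_relation_def borel_reducible_def
    by (intro bexI[of _ "\<lambda>_. 0"]) auto
next
  case False
  define e where "e = from_nat_into I"
  have e: "range e = I" unfolding e_def using False I by (rule range_from_nat_into)
  define f where "f x = ternary (\<lambda>n. P (e n) x)" for x
  have "{x \<in> space M. P (e n) x} \<in> sets M" for n by (rule P) (use e in blast)
  then have "f \<in> borel_measurable M"
    unfolding f_def ternary_def
    by (intro borel_measurable_suminf borel_measurable_times measurable_If borel_measurable_const)
  moreover have "E x y \<longleftrightarrow> f x = f y" if "x \<in> space M" "y \<in> space M" for x y
  proof -
    have "E x y \<longleftrightarrow> (\<forall>n. P (e n) x \<longleftrightarrow> P (e n) y)"
      unfolding E[OF that] e[symmetric] by blast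
    then show ?thesis
      unfolding f_def inj_eq[OF inj_ternary] by (simp add: fun_eq_iff)
  qed
  ultimately show ?thesis
    unfolding smooth_relation_def borel_reducible_def by blast
qed

theorem theorem4p1:
  assumes separable: "\<exists>D :: 'h :: chilbert_space set. countable D \<and> closure D = UNIV"
    and infinite_dimensional: "\<not> fin_dim scaleC (UNIV :: 'h set)"
  shows "smooth_relation (restrict_space Gamma (Gamma_fg :: (nat \<Rightarrow> 'h op) set))
           (\<lambda>\<gamma> \<gamma>'. complete_order_iso (OSy \<gamma>) (OSy \<gamma>'))"
proof (rule smooth_relation_countable_invariants)
  obtain D :: "'h set" where D: "countable D" "closure D = UNIV" using separable by blast
  let ?M = "restrict_space Gamma (Gamma_fg :: (nat \<Rightarrow> 'h op) set)"
  let ?I = "SIGMA d:UNIV. lists (bounds d)"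
  let ?P = "\<lambda>(d, l) \<gamma>. realizes (OSy \<gamma> :: 'h op set) d l"
  show "countable ?I"
    unfolding bounds_def
    by (intro countable_SIGMA countable_lists countable_pencil_coeffs countable_rat) auto
  show "{\<gamma> \<in> space ?M. ?P i \<gamma>} \<in> sets ?M" for i
  proof -
    have "{\<gamma> \<in> space ?M. ?P i \<gamma>} = Gamma_fg \<inter> {\<gamma> \<in> space Gamma. ?P i \<gamma>}"
      by (auto simp: space_restrict_space)
    also have "\<dots> \<in> sets ?M"
      unfolding sets_restrict_space using sets_realizes[OF D] by (cases i) (auto intro: imageI)
    finally show ?thesis .
  qed
  fix \<gamma> \<gamma>' :: "nat \<Rightarrow> 'h op" assume "\<gamma> \<in> space ?M" "\<gamma>' \<in> space ?M"
  then have BH: "\<And>n. \<gamma> n \<in> BH" "\<And>n. \<gamma>' n \<in> BH"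
    and fd: "fin_dim op_scaleC (OSy \<gamma>)" "fin_dim op_scaleC (OSy \<gamma>')"
    by (auto simp: space_restrict_space Gamma_fg_def space_Gamma)
  note os = operator_system_OSy[OF BH(1)] operator_system_OSy[OF BH(2)]
  \<comment> \<open>Embeddability in each direction is an inclusion between the sets of realized
    pairs (d, l); together they say that these sets are equal.\<close>
  show "complete_order_iso (OSy \<gamma>) (OSy \<gamma>') \<longleftrightarrow> (\<forall>i\<in>?I. ?P i \<gamma> \<longleftrightarrow> ?P i \<gamma>')"
    unfolding complete_order_iso_iff_embeddings[OF os(1) fd(1) os(2) fd(2)]
      embedding_iff_realizes[OF os(1) fd(1) os(2) fd(2)]
      embedding_iff_realizes[OF os(2) fd(2) os(1) fd(1)]
    by auto
qed

end
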